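(* Let $t_0<t_1$ be real numbers, let $\alpha>0$, $1<p<\infty$, and let $X$ be a reflexive Banach space. Then $$N_{\alpha,p}<\frac{(t_1-t_0)^\alpha}{\Gamma(\alpha+1)}.$$
   Context: $L^p(t_0,t_1;X)$ is the Bochner-Lebesgue space on $[t_0,t_1]$ with its usual norm. For $\alpha>0$, $J^\alpha_{t_0,t}$ is the bounded linear operator from $L^p(t_0,t_1;X)$ into itself sending $f$ to the (a.e. defined) function $t\mapsto J^\alpha_{t_0,t}f(t):=\frac{1}{\Gamma(\alpha)}\int_{t_0}^t(t-s)^{\alpha-1}f(s)\,ds$ (Bochner integral). $N_{\alpha,p}$ denotes the operator norm of $J^\alpha_{t_0,t}$ from $L^p(t_0,t_1;X)$ into itself. *)

theory Defs
  imports "HOL-Analysis.Analysis"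
begin

definition bidual_embedding ::
    "'a::real_normed_vector \<Rightarrow> (('a \<Rightarrow>\<^sub>L real) \<Rightarrow>\<^sub>L real)" where
  "bidual_embedding x = Blinfun (\<lambda>f. blinfun_apply f x)"

lemma bidual_embedding_apply: "blinfun_apply (bidual_embedding x) f = blinfun_apply f x"
  unfolding bidual_embedding_def
  by (simp add: bounded_linear_Blinfun_apply blinfun.bounded_linear_left)

definition reflexive_space :: "'a::real_normed_vector itself \<Rightarrow> bool" where
  "reflexive_space _ \<longleftrightarrow> surj (bidual_embedding :: 'a \<Rightarrow> (('a \<Rightarrow>\<^sub>L real) \<Rightarrow>\<^sub>L real))"

(* The library's has_bochner_integral and integrable are restricted to second countable (that is,
   separable) target spaces.  The following notions are the Bochner ones for an arbitrary normed
   target; the library's simple functions and their integrals carry no such restriction. *)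

definition strongly_measurable :: "'m measure \<Rightarrow> ('m \<Rightarrow> 'a::real_normed_vector) \<Rightarrow> bool" where
  "strongly_measurable M f \<longleftrightarrow>
     (\<exists>s. (\<forall>i. simple_function M (s i)) \<and> (AE x in M. (\<lambda>i::nat. s i x) \<longlonglongrightarrow> f x))"

definition has_strong_integral ::
    "'m measure \<Rightarrow> ('m \<Rightarrow> 'a::real_normed_vector) \<Rightarrow> 'a \<Rightarrow> bool" where
  "has_strong_integral M f y \<longleftrightarrow> strongly_measurable M f \<and>
     (\<exists>s. (\<forall>i. Bochner_Integration.simple_bochner_integrable M (s i)) \<and>
          (\<lambda>i::nat. \<integral>\<^sup>+ x. ennreal (norm (f x - s i x)) \<partial>M) \<longlonglongrightarrow> 0 \<and>
          (\<lambda>i. Bochner_Integration.simple_bochner_integral M (s i)) \<longlonglongrightarrow> y)"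

(* As for the library's integral, the value is 0 if f is not Bochner integrable. *)
definition strong_integral :: "'m measure \<Rightarrow> ('m \<Rightarrow> 'a::real_normed_vector) \<Rightarrow> 'a" where
  "strong_integral M f =
     (if \<exists>y. has_strong_integral M f y then THE y. has_strong_integral M f y else 0)"

(* Elements are functions on the whole line, of which only the restriction to {t0..t1} matters;
   functions that agree almost everywhere on {t0..t1} are not identified. *)
definition Lp_space :: "real \<Rightarrow> real \<Rightarrow> real \<Rightarrow> (real \<Rightarrow> 'a::real_normed_vector) set" where
  "Lp_space p t0 t1 = {f. strongly_measurable (lebesgue_on {t0..t1}) f \<and>
     (\<integral>\<^sup>+ t. ennreal (norm (f t) powr p) \<partial>lebesgue_on {t0..t1}) < \<infinity>}"

definition Lp_norm :: "real \<Rightarrow> real \<Rightarrow> real \<Rightarrow> (real \<Rightarrow> 'a::real_normed_vector) \<Rightarrow> real" where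
  "Lp_norm p t0 t1 f =
     enn2real (\<integral>\<^sup>+ t. ennreal (norm (f t) powr p) \<partial>lebesgue_on {t0..t1}) powr (1 / p)"

(* The supremum of the norms over the closed unit ball, taken in [0,\<infinity>]: it is \<infinity> if T does not map
   the unit ball into the space, or is unbounded on it. *)
definition Lp_operator_norm ::
    "real \<Rightarrow> real \<Rightarrow> real \<Rightarrow> ((real \<Rightarrow> 'a::real_normed_vector) \<Rightarrow> real \<Rightarrow> 'a) \<Rightarrow> ennreal" where
  "Lp_operator_norm p t0 t1 T =
     (SUP f\<in>{f \<in> Lp_space p t0 t1. Lp_norm p t0 t1 f \<le> 1}.
        if T f \<in> Lp_space p t0 t1 then ennreal (Lp_norm p t0 t1 (T f)) else \<infinity>)"

definition fractional_integral ::
    "real \<Rightarrow> real \<Rightarrow> (real \<Rightarrow> 'a::real_normed_vector) \<Rightarrow> real \<Rightarrow> 'a" where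
  "fractional_integral \<alpha> t0 f t =
     (1 / Gamma \<alpha>) *\<^sub>R
       strong_integral (lebesgue_on {t0..t}) (\<lambda>s. ((t - s) powr (\<alpha> - 1)) *\<^sub>R f s)"

end

theory Submission
  imports Defs
begin

text \<open>
  Write \<open>T = t\<^sub>1 - t\<^sub>0\<close>, \<open>k(u) = u\<^bsup>\<alpha>-1\<^esup>\<close> and \<open>K(u) = u\<^bsup>\<alpha>\<^esup>/\<alpha>\<close>, the primitive of \<open>k\<close>.  The bound
  \<open>K(T)/\<Gamma>(\<alpha>)\<close> for the norm is Young's inequality for convolutions, which spends the full mass
  \<open>K(T)\<close> of the kernel at every time.  At time \<open>t\<close> only the mass \<open>K(t - t\<^sub>0)\<close> is there, and
  keeping track of this gives a quantitative gain.  By Hoelder's inequality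
  \<open>\<parallel>\<Gamma>(\<alpha>) J\<^bsup>\<alpha>\<^esup> f(t)\<parallel>\<^bsup>p\<^esup>\<close> is at most \<open>K(t-t\<^sub>0)\<^bsup>p-1\<^esup>\<close> times the integral of \<open>k(t-s) \<parallel>f(s)\<parallel>\<^bsup>p\<^esup>\<close> over
  \<open>s \<in> [t\<^sub>0,t]\<close>.  Integration over \<open>t\<close> and Tonelli's theorem lead to the Schur type constant that is
  the supremum over \<open>s\<close> of the integral of \<open>K(t-t\<^sub>0)\<^bsup>p-1\<^esup> k(t-s)\<close> over \<open>t \<in> [s,t\<^sub>1]\<close>.
  It is strictly less than \<open>K(T)\<^bsup>p\<^esup>\<close>: if \<open>s\<close> lies in the right half of the interval, the mass of
  the kernel is at most \<open>K(T/2)\<close>; if \<open>s\<close> lies in the left half, then the mass \<open>K(T/4)\<close> of the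
  kernel is met at times before \<open>t\<^sub>0 + 3T/4\<close>, where the weight \<open>K(t-t\<^sub>0)\<^bsup>p-1\<^esup>\<close> is bounded away from its
  maximum because \<open>p > 1\<close> (lemma \<open>weighted_kernel_bound\<close>).  One constant serves all
  \<open>f\<close>, so the strict inequality survives the supremum over the unit ball.

  That \<open>J\<^bsup>\<alpha>\<^esup> f\<close> belongs to \<open>L\<^bsup>p\<^esup>\<close> at all includes that it is strongly measurable.  Simple
  functions \<open>s\<^sub>n\<close> with \<open>\<parallel>s\<^sub>n\<parallel> \<le> 2\<parallel>f\<parallel>\<close> converge to \<open>f\<close>; by dominated convergence \<open>J\<^bsup>\<alpha>\<^esup> s\<^sub>n(t)\<close> tends to
  \<open>J\<^bsup>\<alpha>\<^esup> f(t)\<close> whenever \<open>\<integral> k(t-s)\<parallel>f(s)\<parallel> ds\<close> is finite, hence for almost every \<open>t\<close>.  Each \<open>J\<^bsup>\<alpha>\<^esup> s\<^sub>n\<close> is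
  a finite combination of fixed vectors with bounded measurable real coefficients, and rounding
  the coefficients makes it simple up to a uniformly small error
  (lemmas \<open>strong_integral_weighted_tendsto\<close> and \<open>strong_integral_weighted_simple_approximation\<close>).
\<close>

section \<open>The Bochner integral in a possibly nonseparable space\<close>

lemma strongly_measurable_cong_AE:
  assumes "AE x in M. f x = g x" "strongly_measurable M f"
  shows "strongly_measurable M g"
proof -
  obtain s where s: "\<And>i. simple_function M (s i)" "AE x in M. (\<lambda>i::nat. s i x) \<longlonglongrightarrow> f x"
    using assms(2) unfolding strongly_measurable_def by blast
  have "AE x in M. (\<lambda>i. s i x) \<longlonglongrightarrow> g x"
    using s(2) assms(1) by eventually_elim simp
  with s(1) show ?thesis unfolding strongly_measurable_def by blast
qed

lemma strongly_measurable_simple_function: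
  "simple_function M f \<Longrightarrow> strongly_measurable M f"
  unfolding strongly_measurable_def by (intro exI[of _ "\<lambda>_. f"]) simp

lemma strongly_measurable_pointwise:
  fixes f :: "'m \<Rightarrow> 'a::real_normed_vector"
  assumes "\<And>i. simple_function M (s i)" "\<And>x. x \<in> space M \<Longrightarrow> (\<lambda>i::nat. s i x) \<longlonglongrightarrow> f x"
  shows "strongly_measurable M f"
  unfolding strongly_measurable_def using assms by (intro exI[of _ s]) auto

lemma strongly_measurable_add:
  assumes "strongly_measurable M f" "strongly_measurable M g"
  shows "strongly_measurable M (\<lambda>x. f x + g x)"
proof -
  obtain s where s: "\<And>i. simple_function M (s i)" "AE x in M. (\<lambda>i::nat. s i x) \<longlonglongrightarrow> f x"
    using assms(1) unfolding strongly_measurable_def by blast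
  obtain r where r: "\<And>i. simple_function M (r i)" "AE x in M. (\<lambda>i::nat. r i x) \<longlonglongrightarrow> g x"
    using assms(2) unfolding strongly_measurable_def by blast
  have "simple_function M (\<lambda>x. s i x + r i x)" for i
    using s(1) r(1) by (rule simple_function_compose2)
  moreover have "AE x in M. (\<lambda>i. s i x + r i x) \<longlonglongrightarrow> f x + g x"
    using s(2) r(2) by eventually_elim (rule tendsto_add)
  ultimately show ?thesis
    unfolding strongly_measurable_def by (intro exI[of _ "\<lambda>i x. s i x + r i x"]) auto
qed

lemma strongly_measurable_bounded_linear:
  assumes "bounded_linear T" "strongly_measurable M f"
  shows "strongly_measurable M (\<lambda>x. T (f x))"
proof -
  obtain s where s: "\<And>i. simple_function M (s i)" "AE x in M. (\<lambda>i::nat. s i x) \<longlonglongrightarrow> f x"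
    using assms(2) unfolding strongly_measurable_def by blast
  have "simple_function M (\<lambda>x. T (s i x))" for i
    using s(1) by (rule simple_function_compose1)
  moreover have "AE x in M. (\<lambda>i. T (s i x)) \<longlonglongrightarrow> T (f x)"
    using s(2) by eventually_elim (rule bounded_linear.tendsto[OF assms(1)])
  ultimately show ?thesis
    unfolding strongly_measurable_def by (intro exI[of _ "\<lambda>i x. T (s i x)"]) auto
qed

lemma strongly_measurable_diff:
  assumes "strongly_measurable M f" "strongly_measurable M g"
  shows "strongly_measurable M (\<lambda>x. f x - g x)"
  using strongly_measurable_add[OF assms(1) strongly_measurable_bounded_linear[OF
      bounded_linear_minus[OF bounded_linear_ident] assms(2)]] by simp

text \<open>
  The integrand \<open>\<parallel>f - s\<parallel>\<close> in the definition of the integral need not be measurable, because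
  strong measurability determines \<open>f\<close> only almost everywhere and the measure may be incomplete.
  A measurable version of the norm is all that additivity of the integral on \<open>[0,\<infinity>]\<close> requires.
\<close>
lemma strongly_measurable_norm:
  assumes "strongly_measurable M f"
  obtains g :: "'m \<Rightarrow> ennreal" where "g \<in> borel_measurable M" "AE x in M. ennreal (norm (f x)) = g x"
proof -
  obtain s where s: "\<And>i. simple_function M (s i)" "AE x in M. (\<lambda>i::nat. s i x) \<longlonglongrightarrow> f x"
    using assms unfolding strongly_measurable_def by blast
  define g where "g x = liminf (\<lambda>i. ennreal (norm (s i x)))" for x
  have "simple_function M (\<lambda>x. ennreal (norm (s i x)))" for i
    using s(1) by (rule simple_function_compose1)
  then have "(\<lambda>x. ennreal (norm (s i x))) \<in> borel_measurable M" for i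
    by (rule borel_measurable_simple_function)
  then have "g \<in> borel_measurable M"
    unfolding g_def by (intro borel_measurable_liminf)
  moreover have "AE x in M. ennreal (norm (f x)) = g x"
    using s(2)
  proof eventually_elim
    case (elim x)
    then have "(\<lambda>i. ennreal (norm (s i x))) \<longlonglongrightarrow> ennreal (norm (f x))"
      by (intro tendsto_ennrealI tendsto_norm)
    then show ?case unfolding g_def by (rule lim_imp_Liminf[symmetric, OF sequentially_bot])
  qed
  ultimately show ?thesis by (rule that)
qed

lemma nn_integral_norm_le_add:
  assumes "strongly_measurable M f" "strongly_measurable M g"
    and "\<And>x. norm (h x) \<le> norm (f x) + norm (g x)"
  shows "(\<integral>\<^sup>+x. norm (h x) \<partial>M) \<le> (\<integral>\<^sup>+x. norm (f x) \<partial>M) + (\<integral>\<^sup>+x. norm (g x) \<partial>M)"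
proof -
  obtain u where u: "u \<in> borel_measurable M" "AE x in M. ennreal (norm (f x)) = u x"
    using strongly_measurable_norm[OF assms(1)] .
  obtain v where v: "v \<in> borel_measurable M" "AE x in M. ennreal (norm (g x)) = v x"
    using strongly_measurable_norm[OF assms(2)] .
  have "(\<integral>\<^sup>+x. norm (h x) \<partial>M) \<le> (\<integral>\<^sup>+x. u x + v x \<partial>M)"
    using u(2) v(2)
  proof (intro nn_integral_mono_AE, eventually_elim)
    case (elim x)
    have "ennreal (norm (h x)) \<le> ennreal (norm (f x) + norm (g x))"
      by (intro ennreal_leI assms(3))
    with elim show ?case by simp
  qed
  also have "\<dots> = (\<integral>\<^sup>+x. u x \<partial>M) + (\<integral>\<^sup>+x. v x \<partial>M)"
    using u v by (intro nn_integral_add)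
  also have "\<dots> = (\<integral>\<^sup>+x. norm (f x) \<partial>M) + (\<integral>\<^sup>+x. norm (g x) \<partial>M)"
    using u(2) v(2) by (intro arg_cong2[where f="(+)"] nn_integral_cong_AE) auto
  finally show ?thesis .
qed

lemma ennreal_tendsto_0_le:
  fixes a b :: "nat \<Rightarrow> ennreal"
  assumes "\<And>i. a i \<le> b i" "b \<longlonglongrightarrow> 0"
  shows "a \<longlonglongrightarrow> 0"
  by (rule tendsto_sandwich[where f="\<lambda>_. 0" and h=b]) (use assms in auto)

lemma has_strong_integralE:
  assumes "has_strong_integral M f y"
  obtains s where "strongly_measurable M f"
    "\<And>i. Bochner_Integration.simple_bochner_integrable M (s i)"
    "(\<lambda>i::nat. \<integral>\<^sup>+ x. ennreal (norm (f x - s i x)) \<partial>M) \<longlonglongrightarrow> 0"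
    "(\<lambda>i. Bochner_Integration.simple_bochner_integral M (s i)) \<longlonglongrightarrow> y"
    "\<And>i. strongly_measurable M (\<lambda>x. f x - s i x)"
proof -
  obtain s where s: "strongly_measurable M f"
    "\<And>i. Bochner_Integration.simple_bochner_integrable M (s i)"
    "(\<lambda>i::nat. \<integral>\<^sup>+ x. ennreal (norm (f x - s i x)) \<partial>M) \<longlonglongrightarrow> 0"
    "(\<lambda>i. Bochner_Integration.simple_bochner_integral M (s i)) \<longlonglongrightarrow> y"
    using assms unfolding has_strong_integral_def by blast
  moreover have "strongly_measurable M (\<lambda>x. f x - s i x)" for i
    using s(2)[of i]
    by (intro strongly_measurable_diff s(1) strongly_measurable_simple_function)
       (rule Bochner_Integration.simple_bochner_integrable.cases)
  ultimately show ?thesis using that by blast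
qed

lemma has_strong_integralI:
  assumes "strongly_measurable M f"
    "\<And>i. Bochner_Integration.simple_bochner_integrable M (s i)"
    "(\<lambda>i::nat. \<integral>\<^sup>+ x. ennreal (norm (f x - s i x)) \<partial>M) \<longlonglongrightarrow> 0"
    "(\<lambda>i. Bochner_Integration.simple_bochner_integral M (s i)) \<longlonglongrightarrow> y"
  shows "has_strong_integral M f y"
  unfolding has_strong_integral_def using assms by blast

lemma has_strong_integral_cong_AE:
  fixes f g :: "'m \<Rightarrow> 'a::real_normed_vector"
  assumes "AE x in M. f x = g x" "has_strong_integral M f y"
  shows "has_strong_integral M g y"
proof -
  have "(\<integral>\<^sup>+ x. ennreal (norm (f x - s x)) \<partial>M) = (\<integral>\<^sup>+ x. ennreal (norm (g x - s x)) \<partial>M)"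
    for s :: "'m \<Rightarrow> 'a"
    using assms(1) by (intro nn_integral_cong_AE) auto
  then show ?thesis
    using assms strongly_measurable_cong_AE[OF assms(1)] unfolding has_strong_integral_def by simp
qed

lemma strong_integral_cong_AE:
  assumes "AE x in M. f x = g x"
  shows "strong_integral M f = strong_integral M g"
proof -
  have "AE x in M. g x = f x" using assms by eventually_elim simp
  then have "has_strong_integral M f = has_strong_integral M g"
    using assms by (intro ext iffI) (auto intro: has_strong_integral_cong_AE)
  then show ?thesis unfolding strong_integral_def by (simp only:)
qed

text \<open>
  Uniqueness of the integral rests on this bound: two values differ by an integral of the zero
  function.
\<close>
lemma norm_has_strong_integral_le:
  assumes "has_strong_integral M f y"
  shows "ennreal (norm y) \<le> (\<integral>\<^sup>+x. norm (f x) \<partial>M)"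
proof -
  obtain s where s: "strongly_measurable M f"
    "\<And>i. Bochner_Integration.simple_bochner_integrable M (s i)"
    "(\<lambda>i::nat. \<integral>\<^sup>+ x. ennreal (norm (f x - s i x)) \<partial>M) \<longlonglongrightarrow> 0"
    "(\<lambda>i. Bochner_Integration.simple_bochner_integral M (s i)) \<longlonglongrightarrow> y"
    "\<And>i. strongly_measurable M (\<lambda>x. f x - s i x)"
    using has_strong_integralE[OF assms] by blast
  have le: "ennreal (norm (Bochner_Integration.simple_bochner_integral M (s i)))
      \<le> (\<integral>\<^sup>+x. norm (f x) \<partial>M) + (\<integral>\<^sup>+x. norm (f x - s i x) \<partial>M)" for i
  proof -
    have "ennreal (norm (Bochner_Integration.simple_bochner_integral M (s i)))
        \<le> ennreal (Bochner_Integration.simple_bochner_integral M (\<lambda>x. norm (s i x)))"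
      by (intro ennreal_leI simple_bochner_integral_norm_bound s)
    also have "\<dots> = (\<integral>\<^sup>+x. norm (s i x) \<partial>M)"
      by (intro simple_bochner_integral_eq_nn_integral)
         (auto intro: simple_bochner_integrable_compose2[where p="\<lambda>x y. norm x", OF _ s(2) s(2)])
    also have "\<dots> \<le> (\<integral>\<^sup>+x. norm (f x) \<partial>M) + (\<integral>\<^sup>+x. norm (f x - s i x) \<partial>M)"
      by (intro nn_integral_norm_le_add s(1,5)) (metis norm_triangle_sub add.commute norm_minus_commute)
    finally show ?thesis .
  qed
  have "(\<lambda>i. ennreal (norm (Bochner_Integration.simple_bochner_integral M (s i)))) \<longlonglongrightarrow> ennreal (norm y)"
    by (intro tendsto_ennrealI tendsto_norm s)
  moreover have "(\<lambda>i. (\<integral>\<^sup>+x. norm (f x) \<partial>M) + (\<integral>\<^sup>+x. norm (f x - s i x) \<partial>M)) \<longlonglongrightarrow> (\<integral>\<^sup>+x. norm (f x) \<partial>M) + 0"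
    by (intro tendsto_add tendsto_const s)
  ultimately have "ennreal (norm y) \<le> (\<integral>\<^sup>+x. norm (f x) \<partial>M) + 0"
    by (rule LIMSEQ_le) (use le in blast)
  then show ?thesis by simp
qed

lemma has_strong_integral_add:
  assumes "has_strong_integral M f y" "has_strong_integral M g z"
  shows "has_strong_integral M (\<lambda>x. f x + g x) (y + z)"
proof -
  obtain s where s: "strongly_measurable M f"
    "\<And>i. Bochner_Integration.simple_bochner_integrable M (s i)"
    "(\<lambda>i::nat. \<integral>\<^sup>+ x. ennreal (norm (f x - s i x)) \<partial>M) \<longlonglongrightarrow> 0"
    "(\<lambda>i. Bochner_Integration.simple_bochner_integral M (s i)) \<longlonglongrightarrow> y"
    "\<And>i. strongly_measurable M (\<lambda>x. f x - s i x)"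
    using has_strong_integralE[OF assms(1)] by blast
  obtain r where r: "strongly_measurable M g"
    "\<And>i. Bochner_Integration.simple_bochner_integrable M (r i)"
    "(\<lambda>i::nat. \<integral>\<^sup>+ x. ennreal (norm (g x - r i x)) \<partial>M) \<longlonglongrightarrow> 0"
    "(\<lambda>i. Bochner_Integration.simple_bochner_integral M (r i)) \<longlonglongrightarrow> z"
    "\<And>i. strongly_measurable M (\<lambda>x. g x - r i x)"
    using has_strong_integralE[OF assms(2)] by blast
  have le: "(\<integral>\<^sup>+ x. ennreal (norm (f x + g x - (s i x + r i x))) \<partial>M)
      \<le> (\<integral>\<^sup>+ x. ennreal (norm (f x - s i x)) \<partial>M) + (\<integral>\<^sup>+ x. ennreal (norm (g x - r i x)) \<partial>M)" for i
    by (intro nn_integral_norm_le_add s r norm_diff_triangle_ineq)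
  have "(\<lambda>i. (\<integral>\<^sup>+ x. ennreal (norm (f x - s i x)) \<partial>M) + (\<integral>\<^sup>+ x. ennreal (norm (g x - r i x)) \<partial>M)) \<longlonglongrightarrow> 0 + 0"
    by (intro tendsto_add s r)
  then have "(\<lambda>i. \<integral>\<^sup>+ x. ennreal (norm (f x + g x - (s i x + r i x))) \<partial>M) \<longlonglongrightarrow> 0"
    by (intro ennreal_tendsto_0_le[OF le]) simp
  moreover have "Bochner_Integration.simple_bochner_integrable M (\<lambda>x. s i x + r i x)" for i
    by (rule simple_bochner_integrable_compose2[OF _ s(2) r(2)]) simp
  moreover have "(\<lambda>i. Bochner_Integration.simple_bochner_integral M (\<lambda>x. s i x + r i x)) \<longlonglongrightarrow> y + z"
    by (subst simple_bochner_integral_add[OF s(2) r(2)]) (intro tendsto_add s r)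
  ultimately show ?thesis
    by (intro has_strong_integralI[where s="\<lambda>i x. s i x + r i x"] strongly_measurable_add s(1) r(1))
qed

lemma has_strong_integral_bounded_linear:
  assumes "bounded_linear T" "has_strong_integral M f y"
  shows "has_strong_integral M (\<lambda>x. T (f x)) (T y)"
proof -
  interpret T: bounded_linear T by fact
  obtain s where s: "strongly_measurable M f"
    "\<And>i. Bochner_Integration.simple_bochner_integrable M (s i)"
    "(\<lambda>i::nat. \<integral>\<^sup>+ x. ennreal (norm (f x - s i x)) \<partial>M) \<longlonglongrightarrow> 0"
    "(\<lambda>i. Bochner_Integration.simple_bochner_integral M (s i)) \<longlonglongrightarrow> y"
    "\<And>i. strongly_measurable M (\<lambda>x. f x - s i x)"
    using has_strong_integralE[OF assms(2)] by blast
  obtain K where K: "K > 0" "\<And>x. norm (T x) \<le> norm x * K"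
    using T.pos_bounded by blast
  have le: "(\<integral>\<^sup>+ x. ennreal (norm (T (f x) - T (s i x))) \<partial>M)
      \<le> ennreal K * (\<integral>\<^sup>+ x. ennreal (norm (f x - s i x)) \<partial>M)" for i
  proof -
    obtain u where u: "u \<in> borel_measurable M" "AE x in M. ennreal (norm (f x - s i x)) = u x"
      using strongly_measurable_norm[OF s(5)[of i]] .
    have "(\<integral>\<^sup>+ x. ennreal (norm (T (f x) - T (s i x))) \<partial>M) \<le> (\<integral>\<^sup>+ x. ennreal K * u x \<partial>M)"
      using u(2)
    proof (intro nn_integral_mono_AE, eventually_elim)
      case (elim x)
      have "ennreal (norm (T (f x) - T (s i x))) \<le> ennreal (K * norm (f x - s i x))"
        using K(2)[of "f x - s i x"] by (intro ennreal_leI) (simp add: T.diff mult.commute)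
      with elim K(1) show ?case by (simp add: ennreal_mult)
    qed
    also have "\<dots> = ennreal K * (\<integral>\<^sup>+ x. u x \<partial>M)" by (intro nn_integral_cmult u)
    also have "\<dots> = ennreal K * (\<integral>\<^sup>+ x. ennreal (norm (f x - s i x)) \<partial>M)"
      using u(2) by (intro arg_cong2[where f="(*)"] nn_integral_cong_AE) auto
    finally show ?thesis .
  qed
  have "(\<lambda>i. ennreal K * (\<integral>\<^sup>+ x. ennreal (norm (f x - s i x)) \<partial>M)) \<longlonglongrightarrow> ennreal K * 0"
    by (intro ennreal_tendsto_cmult s) simp
  then have "(\<lambda>i. \<integral>\<^sup>+ x. ennreal (norm (T (f x) - T (s i x))) \<partial>M) \<longlonglongrightarrow> 0"
    by (intro ennreal_tendsto_0_le[OF le]) simp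
  moreover have "Bochner_Integration.simple_bochner_integrable M (\<lambda>x. T (s i x))" for i
    by (rule simple_bochner_integrable_compose2[where p="\<lambda>x y. T x", OF _ s(2) s(2)]) (simp add: T.zero)
  moreover have "(\<lambda>i. Bochner_Integration.simple_bochner_integral M (\<lambda>x. T (s i x))) \<longlonglongrightarrow> T y"
    by (subst simple_bochner_integral_linear[OF T.linear s(2)]) (intro T.tendsto s)
  ultimately show ?thesis
    by (intro has_strong_integralI[where s="\<lambda>i x. T (s i x)"]
        strongly_measurable_bounded_linear[OF assms(1) s(1)])
qed

lemma has_strong_integral_diff:
  assumes "has_strong_integral M f y" "has_strong_integral M g z"
  shows "has_strong_integral M (\<lambda>x. f x - g x) (y - z)"
  using has_strong_integral_add[OF assms(1) has_strong_integral_bounded_linear[OF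
      bounded_linear_minus[OF bounded_linear_ident] assms(2)]] by simp

lemma has_strong_integral_zero: "has_strong_integral M (\<lambda>_. 0 :: 'a::real_normed_vector) 0"
proof -
  have "Bochner_Integration.simple_bochner_integrable M (\<lambda>_. 0::'a)"
    by (intro Bochner_Integration.simple_bochner_integrable.intros) auto
  moreover have "Bochner_Integration.simple_bochner_integral M (\<lambda>_. 0::'a) = 0"
    unfolding Bochner_Integration.simple_bochner_integral_def by (intro sum.neutral) auto
  ultimately show ?thesis
    unfolding has_strong_integral_def
    by (auto intro!: strongly_measurable_simple_function exI[of _ "\<lambda>_ _. 0"])
qed

lemma has_strong_integral_sum:
  assumes "\<And>k. k \<in> A \<Longrightarrow> has_strong_integral M (f k) (y k)"
  shows "has_strong_integral M (\<lambda>x. \<Sum>k\<in>A. f k x) (\<Sum>k\<in>A. y k)"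
  using assms
  by (induction A rule: infinite_finite_induct)
     (auto intro!: has_strong_integral_zero has_strong_integral_add)

lemma strong_integral_eq:
  assumes "has_strong_integral M f y"
  shows "strong_integral M f = y"
proof -
  have "z = y" if "has_strong_integral M f z" for z
  proof -
    have "ennreal (norm (z - y)) \<le> 0"
      using norm_has_strong_integral_le[OF has_strong_integral_diff[OF that assms]] by simp
    then show ?thesis by simp
  qed
  with assms have "(THE z. has_strong_integral M f z) = y" by (rule the_equality)
  with assms show ?thesis unfolding strong_integral_def by auto
qed

lemma norm_strong_integral_le:
  "ennreal (norm (strong_integral M f)) \<le> (\<integral>\<^sup>+x. norm (f x) \<partial>M)"
proof (cases "\<exists>y. has_strong_integral M f y")
  case True
  then show ?thesis using norm_has_strong_integral_le strong_integral_eq by blast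
next
  case False
  then show ?thesis by (simp add: strong_integral_def)
qed

text \<open>
  Dominated convergence makes the given simple functions approximate \<open>f\<close> in \<open>L\<^sup>1\<close>, so their integrals
  form a Cauchy sequence, and completeness supplies the value.  Measurability of the error is not an
  issue: it is an everywhere limit of simple functions.
\<close>
lemma has_strong_integral_dominated:
  fixes f :: "'m \<Rightarrow> 'a::banach"
  assumes s: "\<And>i. simple_function M (s i)"
    and lim: "\<And>x. x \<in> space M \<Longrightarrow> (\<lambda>i::nat. s i x) \<longlonglongrightarrow> f x"
    and w: "w \<in> borel_measurable M" "(\<integral>\<^sup>+x. w x \<partial>M) < \<infinity>"
    and dom: "\<And>i x. x \<in> space M \<Longrightarrow> ennreal (norm (s i x)) \<le> w x"
  shows "has_strong_integral M f (strong_integral M f)"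
proof -
  have sm: "strongly_measurable M f"
    by (rule strongly_measurable_pointwise[OF s lim])
  have meas: "(\<lambda>x. ennreal (norm (f x - s i x))) \<in> borel_measurable M" for i
  proof -
    have "(\<lambda>x. f x - s i x) \<in> borel_measurable M"
    proof (rule borel_measurable_LIMSEQ_metric[where f="\<lambda>j x. s j x - s i x"])
      show "(\<lambda>x. s j x - s i x) \<in> borel_measurable M" for j
        using simple_function_compose2[OF s s, where h="(-)"] by (rule borel_measurable_simple_function)
    qed (intro tendsto_diff lim tendsto_const)
    then show ?thesis by measurable
  qed
  have dom_f: "ennreal (norm (f x)) \<le> w x" if "x \<in> space M" for x
    by (rule LIMSEQ_le_const2[OF tendsto_ennrealI[OF tendsto_norm[OF lim[OF that]]]])
       (use dom[OF that] in auto)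
  have "(\<lambda>i. \<integral>\<^sup>+x. norm (f x - s i x) \<partial>M) \<longlonglongrightarrow> (\<integral>\<^sup>+x. 0 \<partial>M)"
  proof (rule nn_integral_dominated_convergence[where w="\<lambda>x. 2 * w x"])
    show "AE x in M. (\<lambda>i. ennreal (norm (f x - s i x))) \<longlonglongrightarrow> 0"
    proof (rule AE_I2)
      fix x assume "x \<in> space M"
      then have "(\<lambda>i. norm (f x - s i x)) \<longlonglongrightarrow> norm (f x - f x)"
        by (intro tendsto_norm tendsto_diff lim tendsto_const)
      then have "(\<lambda>i. norm (f x - s i x)) \<longlonglongrightarrow> 0" by simp
      from tendsto_ennrealI[OF this] show "(\<lambda>i. ennreal (norm (f x - s i x))) \<longlonglongrightarrow> 0" by simp
    qed
    show "AE x in M. ennreal (norm (f x - s i x)) \<le> 2 * w x" for i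
    proof (rule AE_I2)
      fix x assume x: "x \<in> space M"
      have "ennreal (norm (f x - s i x)) \<le> ennreal (norm (f x) + norm (s i x))"
        by (intro ennreal_leI norm_triangle_ineq4)
      also have "\<dots> = ennreal (norm (f x)) + ennreal (norm (s i x))" by simp
      also have "\<dots> \<le> w x + w x" using dom[OF x] dom_f[OF x] by (intro add_mono)
      finally show "ennreal (norm (f x - s i x)) \<le> 2 * w x" by (simp add: mult_2)
    qed
    show "(\<integral>\<^sup>+ x. 2 * w x \<partial>M) < \<infinity>"
      using w by (simp add: nn_integral_cmult ennreal_mult_less_top)
  qed (use w meas in auto)
  then have L1: "(\<lambda>i. \<integral>\<^sup>+x. norm (f x - s i x) \<partial>M) \<longlonglongrightarrow> 0" by simp
  have sbi: "Bochner_Integration.simple_bochner_integrable M (s i)" for i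
  proof (rule simple_bochner_integrableI_bounded[OF s])
    have "(\<integral>\<^sup>+x. norm (s i x) \<partial>M) \<le> (\<integral>\<^sup>+x. w x \<partial>M)"
      using dom by (intro nn_integral_mono)
    then show "(\<integral>\<^sup>+x. norm (s i x) \<partial>M) < \<infinity>" using w(2) by (rule le_less_trans)
  qed
  have diff_le: "ennreal (norm (Bochner_Integration.simple_bochner_integral M (s i) - Bochner_Integration.simple_bochner_integral M (s j)))
      \<le> (\<integral>\<^sup>+x. norm (f x - s i x) \<partial>M) + (\<integral>\<^sup>+x. norm (f x - s j x) \<partial>M)" for i j
  proof -
    have sbi': "Bochner_Integration.simple_bochner_integrable M (\<lambda>x. s i x - s j x)"
      by (rule simple_bochner_integrable_compose2[OF _ sbi sbi]) simp
    have "ennreal (norm (Bochner_Integration.simple_bochner_integral M (s i) - Bochner_Integration.simple_bochner_integral M (s j)))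
        = ennreal (norm (Bochner_Integration.simple_bochner_integral M (\<lambda>x. s i x - s j x)))"
      by (simp add: simple_bochner_integral_diff sbi)
    also have "\<dots> \<le> ennreal (Bochner_Integration.simple_bochner_integral M (\<lambda>x. norm (s i x - s j x)))"
      by (intro ennreal_leI simple_bochner_integral_norm_bound sbi')
    also have "\<dots> = (\<integral>\<^sup>+x. norm (s i x - s j x) \<partial>M)"
      by (intro simple_bochner_integral_eq_nn_integral)
         (auto intro: simple_bochner_integrable_compose2[where p="\<lambda>x y. norm x", OF _ sbi' sbi'])
    also have "\<dots> \<le> (\<integral>\<^sup>+x. norm (f x - s i x) \<partial>M) + (\<integral>\<^sup>+x. norm (f x - s j x) \<partial>M)"
      by (intro nn_integral_norm_le_add strongly_measurable_diff sm
          strongly_measurable_simple_function[OF s])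
         (auto intro: order_trans[OF _ norm_triangle_ineq4] simp: norm_minus_commute)
    finally show ?thesis .
  qed
  have "Cauchy (\<lambda>i. Bochner_Integration.simple_bochner_integral M (s i))"
  proof (rule metric_CauchyI)
    fix e :: real assume "e > 0"
    then have "eventually (\<lambda>i. (\<integral>\<^sup>+x. norm (f x - s i x) \<partial>M) < ennreal (e/2)) sequentially"
      by (intro order_tendstoD(2)[OF L1]) simp
    then obtain N where N: "\<And>i. i \<ge> N \<Longrightarrow> (\<integral>\<^sup>+x. norm (f x - s i x) \<partial>M) < ennreal (e/2)"
      by (auto simp: eventually_sequentially)
    have "dist (Bochner_Integration.simple_bochner_integral M (s i)) (Bochner_Integration.simple_bochner_integral M (s j)) < e"
      if "i \<ge> N" "j \<ge> N" for i j
    proof -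
      have "ennreal (norm (Bochner_Integration.simple_bochner_integral M (s i) - Bochner_Integration.simple_bochner_integral M (s j)))
          < ennreal (e/2) + ennreal (e/2)"
        using diff_le add_strict_mono[OF N[OF that(1)] N[OF that(2)]] by (rule le_less_trans)
      also have "\<dots> = ennreal e" using \<open>e > 0\<close> by (simp flip: ennreal_plus)
      finally show ?thesis by (simp add: dist_norm ennreal_less_iff)
    qed
    then show "\<exists>N. \<forall>i\<ge>N. \<forall>j\<ge>N. dist (Bochner_Integration.simple_bochner_integral M (s i)) (Bochner_Integration.simple_bochner_integral M (s j)) < e"
      by blast
  qed
  then obtain y where "(\<lambda>i. Bochner_Integration.simple_bochner_integral M (s i)) \<longlonglongrightarrow> y"
    by (auto simp: Cauchy_convergent_iff convergent_def)
  then have "has_strong_integral M f y"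
    unfolding has_strong_integral_def using sm sbi L1 by blast
  then show ?thesis using strong_integral_eq by metis
qed

lemma has_strong_integral_real:
  fixes f :: "'m \<Rightarrow> real"
  assumes "has_bochner_integral M f y"
  shows "has_strong_integral M f y"
proof -
  have f: "f \<in> borel_measurable M"
    using assms by (auto elim: has_bochner_integral.cases)
  obtain F where F: "\<And>i. simple_function M (F i)" "\<And>x. x \<in> space M \<Longrightarrow> (\<lambda>i::nat. F i x) \<longlonglongrightarrow> f x"
    using borel_measurable_implies_sequence_metric[OF f, of 0] by blast
  then have "strongly_measurable M f" by (rule strongly_measurable_pointwise)
  then show ?thesis
    using assms unfolding has_strong_integral_def has_bochner_integral.simps by blast
qed

section \<open>The kernel and Hoelder's inequality\<close>

text \<open>
  The integrand kernel cut off to \<open>t\<^sub>0 \<le> s < t\<close>, so that both variables can range over the whole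
  line.  Dropping the endpoint \<open>s = t\<close> changes nothing, as \<open>0 powr a = 0\<close>.
\<close>
definition fractional_kernel :: "real \<Rightarrow> real \<Rightarrow> real \<Rightarrow> real \<Rightarrow> real" where
  "fractional_kernel \<alpha> t0 t s = (if t0 \<le> s \<and> s < t then (t - s) powr (\<alpha> - 1) else 0)"

lemma fractional_kernel_nonneg [simp]: "0 \<le> fractional_kernel \<alpha> t0 t s"
  by (simp add: fractional_kernel_def)

lemma measurable_fractional_kernel [measurable]:
  "case_prod (fractional_kernel \<alpha> t0) \<in> borel_measurable (borel \<Otimes>\<^sub>M borel)"
  unfolding fractional_kernel_def by measurable

lemma nn_integral_powr_from_0:
  assumes "0 < \<alpha>" "0 \<le> (c::real)"
  shows "(\<integral>\<^sup>+x. ennreal (x powr (\<alpha> - 1)) * indicator {0..c} x \<partial>lborel) = ennreal (c powr \<alpha> / \<alpha>)"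
  using nn_integral_has_integral_lebesgue'[OF _ has_integral_powr_from_0[of "\<alpha> - 1" c]] assms by simp

lemma nn_integral_kernel_right:
  assumes "0 < \<alpha>" "t0 \<le> t"
  shows "(\<integral>\<^sup>+s. ennreal (fractional_kernel \<alpha> t0 t s) \<partial>lborel) = ennreal ((t - t0) powr \<alpha> / \<alpha>)"
proof -
  have "ennreal ((t - t0) powr \<alpha> / \<alpha>)
      = (\<integral>\<^sup>+x. ennreal (x powr (\<alpha> - 1)) * indicator {0..t - t0} x \<partial>lborel)"
    using assms by (simp add: nn_integral_powr_from_0)
  also have "\<dots> = ennreal \<bar>-1\<bar> * (\<integral>\<^sup>+s. ennreal ((t + -1 * s) powr (\<alpha> - 1)) * indicator {0..t - t0} (t + -1 * s) \<partial>lborel)"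
    by (rule nn_integral_real_affine) auto
  also have "\<dots> = (\<integral>\<^sup>+s. ennreal (fractional_kernel \<alpha> t0 t s) \<partial>lborel)"
    using assms by (auto intro!: nn_integral_cong simp: fractional_kernel_def indicator_def)
  finally show ?thesis ..
qed

lemma nn_integral_kernel_left:
  assumes "0 < \<alpha>" "t0 \<le> s" "s \<le> b"
  shows "(\<integral>\<^sup>+t. ennreal (fractional_kernel \<alpha> t0 t s) * indicator {..b} t \<partial>lborel) = ennreal ((b - s) powr \<alpha> / \<alpha>)"
proof -
  have "ennreal ((b - s) powr \<alpha> / \<alpha>)
      = (\<integral>\<^sup>+x. ennreal (x powr (\<alpha> - 1)) * indicator {0..b - s} x \<partial>lborel)"
    using assms by (simp add: nn_integral_powr_from_0)
  also have "\<dots> = ennreal \<bar>1\<bar> * (\<integral>\<^sup>+t. ennreal ((- s + 1 * t) powr (\<alpha> - 1)) * indicator {0..b - s} (- s + 1 * t) \<partial>lborel)"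
    by (rule nn_integral_real_affine) auto
  also have "\<dots> = (\<integral>\<^sup>+t. ennreal (fractional_kernel \<alpha> t0 t s) * indicator {..b} t \<partial>lborel)"
    using assms by (auto intro!: nn_integral_cong simp: fractional_kernel_def indicator_def)
  finally show ?thesis ..
qed

text \<open>
  The free parameter \<open>r\<close> replaces Hoelder's inequality: integrating this affine bound and then
  optimizing \<open>r\<close>, as the next lemma does, gives the Hoelder bound without any powers of
  quantities that may be infinite.
\<close>
lemma young_scaled:
  fixes p y r :: real
  assumes "1 < p" "0 \<le> y" "0 < r"
  shows "y \<le> r powr (1 - p) / p * y powr p + r * (1 - 1 / p)"
proof -
  have "(y / r) * 1 \<le> (y / r) powr p / p + 1 powr (1 / (1 - 1 / p)) / (1 / (1 - 1 / p))"
    by (rule Youngs_inequality) (use assms in \<open>auto simp: field_simps\<close>)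
  then have "r * (y / r) \<le> r * ((y / r) powr p / p + (1 - 1 / p))"
    using assms by (intro mult_left_mono) auto
  moreover have "r * ((y / r) powr p) = r powr (1 - p) * y powr p"
    using assms by (simp add: powr_divide powr_diff)
  ultimately show ?thesis using assms by (simp add: field_simps)
qed

lemma powr_le_of_young:
  fixes p x K A :: real
  assumes "1 < p" "0 \<le> x" "0 < K" "0 \<le> A"
    and le: "\<And>r. 0 < r \<Longrightarrow> x \<le> r powr (1 - p) / p * A + r * (1 - 1 / p) * K"
  shows "x powr p \<le> K powr (p - 1) * A"
proof (cases "A = 0")
  case True
  have "x \<le> e" if "e > 0" for e
  proof -
    define d where "d = (1 - 1 / p) * K"
    have "d > 0" unfolding d_def using assms by (auto intro!: mult_pos_pos simp: field_simps)
    then have "x \<le> e / d * (1 - 1 / p) * K"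
      using le[of "e / d"] True that by simp
    also have "\<dots> = e / d * d" unfolding d_def by (simp only: mult.assoc)
    also have "\<dots> = e" using \<open>d > 0\<close> by simp
    finally show ?thesis .
  qed
  then have "x \<le> 0" by (rule field_le_epsilon[of x 0, simplified])
  with assms True show ?thesis by simp
next
  case False
  with assms have A: "A > 0" by simp
  \<comment> \<open>the minimizer of the right-hand side over all \<open>r > 0\<close>\<close>
  define r where "r = (A / K) powr (1 / p)"
  have l: "r > 0" unfolding r_def using A assms by simp
  have lp: "r powr p = A / K" unfolding r_def using A assms by (simp add: powr_powr)
  have "r powr (1 - p) * A = r * K"
    using l lp A assms by (simp add: powr_diff)
  then have "x \<le> r * K"
    using le[OF l] assms by (simp add: field_simps)
  then have "x powr p \<le> (r * K) powr p" using assms by (intro powr_mono2) auto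
  also have "\<dots> = K powr (p - 1) * A"
    using l lp A assms by (simp add: powr_mult powr_diff)
  finally show ?thesis .
qed

lemma nn_integral_young:
  fixes k g :: "'m \<Rightarrow> real"
  assumes "1 < p" "0 < r"
    and [measurable]: "k \<in> borel_measurable M" "g \<in> borel_measurable M"
    and nonneg: "\<And>x. 0 \<le> k x" "\<And>x. 0 \<le> g x"
  shows "(\<integral>\<^sup>+x. ennreal (k x * g x) \<partial>M)
    \<le> ennreal (r powr (1 - p) / p) * (\<integral>\<^sup>+x. ennreal (k x * g x powr p) \<partial>M)
      + ennreal (r * (1 - 1 / p)) * (\<integral>\<^sup>+x. ennreal (k x) \<partial>M)"
proof -
  have c: "0 \<le> r powr (1 - p) / p" "0 \<le> r * (1 - 1 / p)" using assms(1,2) by auto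
  have "(\<integral>\<^sup>+x. ennreal (k x * g x) \<partial>M)
    \<le> (\<integral>\<^sup>+x. ennreal (r powr (1 - p) / p) * ennreal (k x * g x powr p)
        + ennreal (r * (1 - 1 / p)) * ennreal (k x) \<partial>M)"
  proof (rule nn_integral_mono)
    fix x
    have "k x * g x \<le> k x * (r powr (1 - p) / p * g x powr p + r * (1 - 1 / p))"
      using assms(1,2) nonneg by (intro mult_left_mono young_scaled) auto
    also have "\<dots> = r powr (1 - p) / p * (k x * g x powr p) + r * (1 - 1 / p) * k x"
      by (simp add: algebra_simps)
    finally have "ennreal (k x * g x) \<le> ennreal (\<dots>)" by (rule ennreal_leI)
    then show "ennreal (k x * g x) \<le> ennreal (r powr (1 - p) / p) * ennreal (k x * g x powr p)
        + ennreal (r * (1 - 1 / p)) * ennreal (k x)"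
      using c nonneg by (simp flip: ennreal_mult ennreal_plus del: times_divide_eq_left)
  qed
  then show ?thesis by (simp add: nn_integral_add nn_integral_cmult)
qed

text \<open>
  Hoelder's inequality for the measure with density \<open>k\<close>, of total mass \<open>K\<close>.  It is stated for a
  real lower bound \<open>x\<close> of the integral, because that integral itself may be infinite.
\<close>
lemma powr_nn_integral_le:
  fixes k g :: "'m \<Rightarrow> real"
  assumes p: "1 < p"
    and meas: "k \<in> borel_measurable M" "g \<in> borel_measurable M"
    and nonneg: "\<And>x. 0 \<le> k x" "\<And>x. 0 \<le> g x"
    and K: "(\<integral>\<^sup>+x. ennreal (k x) \<partial>M) = ennreal K" "0 < K"
    and x: "0 \<le> x" "ennreal x \<le> (\<integral>\<^sup>+x. ennreal (k x * g x) \<partial>M)"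
  shows "ennreal (x powr p) \<le> ennreal (K powr (p - 1)) * (\<integral>\<^sup>+x. ennreal (k x * g x powr p) \<partial>M)"
proof (cases "\<integral>\<^sup>+x. ennreal (k x * g x powr p) \<partial>M")
  case top
  with K show ?thesis by (simp add: ennreal_mult_top)
next
  case (real A)
  have "x powr p \<le> K powr (p - 1) * A"
  proof (rule powr_le_of_young[OF p x(1) K(2) real(1)])
    fix r :: real assume l: "0 < r"
    then have c: "0 \<le> r powr (1 - p) / p" "0 \<le> r * (1 - 1 / p)" using p by auto
    have "ennreal x \<le> ennreal (r powr (1 - p) / p) * ennreal A + ennreal (r * (1 - 1 / p)) * ennreal K"
      using order_trans[OF x(2) nn_integral_young[OF p l meas nonneg]] K real by simp
    also have "\<dots> = ennreal (r powr (1 - p) / p * A + r * (1 - 1 / p) * K)"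
      using c K real by (simp flip: ennreal_mult ennreal_plus del: times_divide_eq_left)
    finally have le: "ennreal x \<le> ennreal (r powr (1 - p) / p * A + r * (1 - 1 / p) * K)" .
    have "0 \<le> r powr (1 - p) / p * A + r * (1 - 1 / p) * K"
      using K(2) real(1) by (intro add_nonneg_nonneg mult_nonneg_nonneg c) auto
    with le show "x \<le> r powr (1 - p) / p * A + r * (1 - 1 / p) * K"
      by (simp only: ennreal_le_iff)
  qed
  then show ?thesis using real K by (simp add: ennreal_leI flip: ennreal_mult)
qed

section \<open>The Schur constant of the weighted kernel\<close>

text \<open>
  The strict inequality of the theorem comes from here.  On the interval the weight
  \<open>K(t - t\<^sub>0)\<^bsup>p-1\<^esup>\<close> is at most its final value \<open>A\<close>, and up to time \<open>b = t\<^sub>0 + 3T/4\<close> it falls short of \<open>A\<close>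
  by at least some \<open>\<delta> > 0\<close>.  For \<open>s\<close> in the left half of the interval the kernel has mass at least
  \<open>K(T/4)\<close> before \<open>b\<close>, which saves \<open>\<delta> K(T/4)\<close>; for \<open>s\<close> in the right half the kernel has
  mass at most \<open>K(T/2)\<close>.
\<close>
lemma weighted_kernel_bound:
  fixes t0 t1 \<alpha> p :: real
  assumes "t0 < t1" "0 < \<alpha>" "1 < p"
  obtains C where "0 \<le> C" "C < ((t1 - t0) powr \<alpha> / \<alpha>) powr p"
    "\<And>s. s \<in> {t0..t1} \<Longrightarrow>
      (\<integral>\<^sup>+t. ennreal (((t - t0) powr \<alpha> / \<alpha>) powr (p - 1) * fractional_kernel \<alpha> t0 t s) * indicator {t0..t1} t \<partial>lborel) \<le> ennreal C"
proof -
  define T where "T = t1 - t0"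
  define K where "K u = u powr \<alpha> / \<alpha>" for u
  have T: "T > 0" using assms by (simp add: T_def)
  have K_mono: "K u \<le> K v" if "0 \<le> u" "u \<le> v" for u v
    unfolding K_def using that assms by (intro divide_right_mono powr_mono2) auto
  have K_less: "K u < K v" if "0 \<le> u" "u < v" for u v
    unfolding K_def using that assms by (intro divide_strict_right_mono powr_less_mono2) auto
  have K_nonneg: "0 \<le> K u" for u unfolding K_def using assms by simp
  have K_pos: "0 < K u" if "u > 0" for u unfolding K_def using assms that by simp
  define W where "W t = K (t - t0) powr (p - 1)" for t
  define A where "A = K T powr (p - 1)"
  define b where "b = t0 + 3 / 4 * T"
  define \<delta> where "\<delta> = A - W b"
  have A: "A > 0" unfolding A_def using K_pos[OF T] by simp
  have \<delta>: "\<delta> > 0"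
    unfolding \<delta>_def A_def W_def b_def using T assms K_less[of "3/4*T" T] K_nonneg
    by (simp add: powr_less_mono2)
  have AK: "A * K T = K T powr p"
    unfolding A_def using K_pos[OF T] by (simp add: powr_diff)
  have W_le: "W t + \<delta> * indicator {..b} t \<le> A" if "t \<in> {t0..t1}" for t
  proof (cases "t \<le> b")
    case True
    then have "W t \<le> W b"
      unfolding W_def using that assms K_nonneg by (intro powr_mono2 K_mono) auto
    with True show ?thesis by (simp add: \<delta>_def)
  next
    case False
    have "W t \<le> A"
      unfolding W_def A_def T_def using that assms K_nonneg by (intro powr_mono2 K_mono) auto
    with False show ?thesis by simp
  qed
  define C where "C = max (A * K T - \<delta> * K (T / 4)) (A * K (T / 2))"
  have "0 \<le> C" unfolding C_def using A K_nonneg[of "T/2"] by (simp add: le_max_iff_disj)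
  moreover have "C < K T powr p"
    unfolding C_def AK[symmetric]
    using A \<delta> K_pos[of "T/4"] K_less[of "T/2" T] T by simp
  moreover have "(\<integral>\<^sup>+t. ennreal (W t * fractional_kernel \<alpha> t0 t s) * indicator {t0..t1} t \<partial>lborel) \<le> ennreal C"
    (is "?X \<le> _") if s: "s \<in> {t0..t1}" for s
  proof -
    have [measurable]: "W \<in> borel_measurable borel" unfolding W_def K_def by measurable
    have [measurable]: "(\<lambda>t. fractional_kernel \<alpha> t0 t s) \<in> borel_measurable borel" by measurable
    have kl: "(\<integral>\<^sup>+t. ennreal c * (ennreal (fractional_kernel \<alpha> t0 t s) * indicator {..e} t) \<partial>lborel) = ennreal (c * K (e - s))"
      if "s \<le> e" "0 \<le> c" for e c
      using that assms s K_nonneg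
      by (subst nn_integral_cmult) (auto simp: nn_integral_kernel_left K_def simp flip: ennreal_mult)
    have le: "?X + (\<integral>\<^sup>+t. ennreal \<delta> * (ennreal (fractional_kernel \<alpha> t0 t s) * indicator {..b} t) \<partial>lborel)
        \<le> (\<integral>\<^sup>+t. ennreal A * (ennreal (fractional_kernel \<alpha> t0 t s) * indicator {..t1} t) \<partial>lborel)"
    proof (subst nn_integral_add[symmetric])
      show "(\<integral>\<^sup>+t. ennreal (W t * fractional_kernel \<alpha> t0 t s) * indicator {t0..t1} t
            + ennreal \<delta> * (ennreal (fractional_kernel \<alpha> t0 t s) * indicator {..b} t) \<partial>lborel)
          \<le> (\<integral>\<^sup>+t. ennreal A * (ennreal (fractional_kernel \<alpha> t0 t s) * indicator {..t1} t) \<partial>lborel)"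
      proof (rule nn_integral_mono)
        fix t
        consider "t < t0" | "t \<in> {t0..t1}" | "t > t1" by fastforce
        then show "ennreal (W t * fractional_kernel \<alpha> t0 t s) * indicator {t0..t1} t
            + ennreal \<delta> * (ennreal (fractional_kernel \<alpha> t0 t s) * indicator {..b} t)
          \<le> ennreal A * (ennreal (fractional_kernel \<alpha> t0 t s) * indicator {..t1} t)"
        proof cases
          case 1
          then have "fractional_kernel \<alpha> t0 t s = 0" using s by (simp add: fractional_kernel_def)
          then show ?thesis by simp
        next
          case 2
          have "0 \<le> W t" by (simp add: W_def)
          have "ennreal (W t * fractional_kernel \<alpha> t0 t s) * indicator {t0..t1} t
              + ennreal \<delta> * (ennreal (fractional_kernel \<alpha> t0 t s) * indicator {..b} t)
              = ennreal ((W t + \<delta> * indicator {..b} t) * fractional_kernel \<alpha> t0 t s)"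
            using 2 \<delta> \<open>0 \<le> W t\<close> by (auto simp: indicator_def distrib_right ennreal_mult)
          also have "\<dots> \<le> ennreal (A * fractional_kernel \<alpha> t0 t s)"
            using W_le[OF 2] by (intro ennreal_leI mult_right_mono) auto
          finally show ?thesis using 2 A by (simp add: ennreal_mult)
        next
          case 3
          then have "t > b" using T unfolding b_def T_def by (simp add: field_simps)
          with 3 show ?thesis by simp
        qed
      qed
    qed measurable
    show ?thesis
    proof (cases "s \<le> t0 + T / 2")
      case True
      then have sb: "s \<le> b" using T unfolding b_def by simp
      have X: "?X + ennreal (\<delta> * K (b - s)) \<le> ennreal (A * K (t1 - s))"
        using le kl[OF sb] kl[of t1] s A \<delta> by simp
      then have "?X \<noteq> top" by (auto simp: top_unique)
      then obtain x where x: "?X = ennreal x" "0 \<le> x" by (cases ?X) auto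
      have "ennreal (x + \<delta> * K (b - s)) \<le> ennreal (A * K (t1 - s))"
        using X x \<delta> K_nonneg[of "b - s"] by simp
      then have "x + \<delta> * K (b - s) \<le> A * K (t1 - s)"
        using A K_nonneg[of "t1 - s"] by (simp add: ennreal_le_iff)
      moreover have "A * K (t1 - s) \<le> A * K T"
        using A s by (intro mult_left_mono K_mono) (auto simp: T_def)
      moreover have "\<delta> * K (T / 4) \<le> \<delta> * K (b - s)"
        using \<delta> True T by (intro mult_left_mono K_mono) (auto simp: b_def)
      ultimately have "x \<le> C" unfolding C_def by simp
      then show ?thesis unfolding x by (rule ennreal_leI)
    next
      case False
      have "?X \<le> ?X + (\<integral>\<^sup>+t. ennreal \<delta> * (ennreal (fractional_kernel \<alpha> t0 t s) * indicator {..b} t) \<partial>lborel)" by simp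
      also have "\<dots> \<le> ennreal (A * K (t1 - s))"
        using le kl[of t1] s A by simp
      also have "\<dots> \<le> ennreal (A * K (T / 2))"
        using A s False by (intro ennreal_leI mult_left_mono K_mono) (auto simp: T_def field_simps)
      also have "\<dots> \<le> ennreal C" unfolding C_def by (intro ennreal_leI) simp
      finally show ?thesis .
    qed
  qed
  ultimately show ?thesis
    using that[of C] unfolding W_def K_def T_def by blast
qed

text \<open>
  Tonelli's theorem turns a bound on the columns of the weighted kernel into an \<open>L\<^sup>1\<close> bound; it will
  be applied to \<open>g = \<parallel>f\<parallel>\<^bsup>p\<^esup>\<close>.
\<close>
lemma weighted_fubini:
  fixes g :: "real \<Rightarrow> real" and W :: "real \<Rightarrow> real"
  assumes [measurable]: "g \<in> borel_measurable borel" "W \<in> borel_measurable borel"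
    and nonneg: "\<And>x. 0 \<le> g x" "\<And>x. 0 \<le> W x"
    and supp: "\<And>x. x \<notin> {t0..t1} \<Longrightarrow> g x = 0"
    and C: "\<And>s. s \<in> {t0..t1} \<Longrightarrow>
      (\<integral>\<^sup>+t. ennreal (W t * fractional_kernel \<alpha> t0 t s) * indicator {t0..t1} t \<partial>lborel) \<le> ennreal C"
  shows "(\<integral>\<^sup>+t. (ennreal (W t) * (\<integral>\<^sup>+s. ennreal (fractional_kernel \<alpha> t0 t s * g s) \<partial>lborel)) * indicator {t0..t1} t \<partial>lborel)
    \<le> ennreal C * (\<integral>\<^sup>+s. ennreal (g s) \<partial>lborel)"
proof -
  have "(\<integral>\<^sup>+t. (ennreal (W t) * (\<integral>\<^sup>+s. ennreal (fractional_kernel \<alpha> t0 t s * g s) \<partial>lborel)) * indicator {t0..t1} t \<partial>lborel)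
    = (\<integral>\<^sup>+t. (\<integral>\<^sup>+s. ennreal (g s) * (ennreal (W t * fractional_kernel \<alpha> t0 t s) * indicator {t0..t1} t) \<partial>lborel) \<partial>lborel)"
  proof (rule nn_integral_cong)
    fix t
    have "(ennreal (W t) * (\<integral>\<^sup>+s. ennreal (fractional_kernel \<alpha> t0 t s * g s) \<partial>lborel)) * indicator {t0..t1} t
      = (\<integral>\<^sup>+s. (ennreal (W t) * indicator {t0..t1} t) * ennreal (fractional_kernel \<alpha> t0 t s * g s) \<partial>lborel)"
      by (subst nn_integral_cmult) (auto simp: ac_simps)
    also have "\<dots> = (\<integral>\<^sup>+s. ennreal (g s) * (ennreal (W t * fractional_kernel \<alpha> t0 t s) * indicator {t0..t1} t) \<partial>lborel)"
      using nonneg by (intro nn_integral_cong) (simp add: ennreal_mult ac_simps)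
    finally show "(ennreal (W t) * (\<integral>\<^sup>+s. ennreal (fractional_kernel \<alpha> t0 t s * g s) \<partial>lborel)) * indicator {t0..t1} t = \<dots>" .
  qed
  also have "\<dots> = (\<integral>\<^sup>+s. (\<integral>\<^sup>+t. ennreal (g s) * (ennreal (W t * fractional_kernel \<alpha> t0 t s) * indicator {t0..t1} t) \<partial>lborel) \<partial>lborel)"
    by (rule lborel_pair.Fubini'[symmetric]) measurable
  also have "\<dots> \<le> (\<integral>\<^sup>+s. ennreal C * ennreal (g s) \<partial>lborel)"
  proof (rule nn_integral_mono)
    fix s
    have "(\<integral>\<^sup>+t. ennreal (g s) * (ennreal (W t * fractional_kernel \<alpha> t0 t s) * indicator {t0..t1} t) \<partial>lborel)
      = ennreal (g s) * (\<integral>\<^sup>+t. ennreal (W t * fractional_kernel \<alpha> t0 t s) * indicator {t0..t1} t \<partial>lborel)"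
      by (rule nn_integral_cmult) measurable
    also have "\<dots> \<le> ennreal (g s) * ennreal C"
      using C[of s] supp[of s] by (cases "s \<in> {t0..t1}") (auto intro: mult_left_mono)
    finally show "(\<integral>\<^sup>+t. ennreal (g s) * (ennreal (W t * fractional_kernel \<alpha> t0 t s) * indicator {t0..t1} t) \<partial>lborel)
      \<le> ennreal C * ennreal (g s)" by (simp add: mult.commute)
  qed
  also have "\<dots> = ennreal C * (\<integral>\<^sup>+s. ennreal (g s) \<partial>lborel)"
    by (rule nn_integral_cmult) measurable
  finally show ?thesis .
qed

section \<open>Representatives and simple functions on the line\<close>

lemma simple_function_lebesgue_on:
  assumes "simple_function lborel f"
  shows "simple_function (lebesgue_on S) f"
  unfolding simple_function_eq_measurable
proof
  show "finite (f ` space (lebesgue_on S))"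
    using simple_functionD(1)[OF assms] by (rule rev_finite_subset) auto
  show "f \<in> lebesgue_on S \<rightarrow>\<^sub>M count_space UNIV"
    using measurable_simple_function[OF assms]
    by (intro measurable_restrict_space1 measurable_completion)
qed

lemma nn_integral_lebesgue_on:
  assumes "S \<in> sets lebesgue"
  shows "(\<integral>\<^sup>+x. u x \<partial>lebesgue_on S) = (\<integral>\<^sup>+x. u x * indicator S x \<partial>lborel)"
  using assms by (simp add: nn_integral_restrict_space nn_integral_completion)

text \<open>
  Passing to a version \<open>h\<close> that is an everywhere limit of Borel simple functions makes Tonelli's
  theorem for \<open>lborel\<close> and dominated convergence available.  Setting an approximation to 0 wherever
  its norm exceeds \<open>2\<parallel>h\<parallel>\<close> keeps the convergence: where \<open>h \<noteq> 0\<close> this happens only finitely often,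
  and where \<open>h = 0\<close> the result is constantly 0.
\<close>
lemma strongly_measurable_representative:
  fixes f :: "real \<Rightarrow> 'a::real_normed_vector"
  assumes "strongly_measurable (lebesgue_on {t0..t1}) f"
  obtains h s where
    "\<And>i. simple_function lborel (s i)" "\<And>x. (\<lambda>i::nat. s i x) \<longlonglongrightarrow> h x"
    "\<And>i x. norm (s i x) \<le> 2 * norm (h x)" "\<And>x. x \<notin> {t0..t1} \<Longrightarrow> h x = 0"
    "AE x in lebesgue_on {t0..t1}. f x = h x"
proof -
  obtain r where r: "\<And>i. simple_function (lebesgue_on {t0..t1}) (r i)"
    "AE x in lebesgue_on {t0..t1}. (\<lambda>i::nat. r i x) \<longlonglongrightarrow> f x"
    using assms unfolding strongly_measurable_def by blast
  have "\<exists>q. simple_function lborel q \<and> (AE x in lborel. indicator {t0..t1} x *\<^sub>R r i x = q x)" for i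
    using r(1)[of i] by (intro completion_ex_simple_function) (simp add: simple_function_restrict_space)
  then obtain q where q: "\<And>i. simple_function lborel (q i)"
    "\<And>i. AE x in lborel. indicator {t0..t1} x *\<^sub>R r i x = q i x"
    by metis
  have "AE x in lborel. \<forall>i. indicator {t0..t1} x *\<^sub>R r i x = q i x"
    using q(2) by (simp add: AE_all_countable)
  moreover have "AE x in lborel. x \<in> {t0..t1} \<longrightarrow> (\<lambda>i. r i x) \<longlonglongrightarrow> f x"
    using r(2) by (simp add: AE_restrict_space_iff AE_completion_iff)
  ultimately have "AE x in lborel. x \<in> {t0..t1} \<longrightarrow> (\<lambda>i. q i x) \<longlonglongrightarrow> f x"
  proof eventually_elim
    case (elim x)
    show ?case
    proof
      assume x: "x \<in> {t0..t1}"
      then have "(\<lambda>i. r i x) = (\<lambda>i. q i x)" using elim(1) by simp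
      then show "(\<lambda>i. q i x) \<longlonglongrightarrow> f x" using elim(2) x by simp
    qed
  qed
  then obtain N where N: "N \<in> null_sets lborel"
    "{x \<in> space lborel. \<not> (x \<in> {t0..t1} \<longrightarrow> (\<lambda>i. q i x) \<longlonglongrightarrow> f x)} \<subseteq> N"
    unfolding eventually_ae_filter by blast
  define D where "D = {t0..t1} - N"
  have D [measurable]: "D \<in> sets borel"
    using N(1) unfolding D_def by auto
  define q' where "q' i x = (if x \<in> D then q i x else 0)" for i x
  define h where "h x = (if x \<in> D then f x else 0)" for x
  have q': "simple_function lborel (q' i)" for i
    unfolding q'_def by (intro simple_function_If_set q) auto
  have lim: "(\<lambda>i. q' i x) \<longlonglongrightarrow> h x" for x
    using N(2) by (auto simp: q'_def h_def D_def)
  have [measurable]: "q' i \<in> borel_measurable borel" for i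
    using borel_measurable_simple_function[OF q'] by simp
  have [measurable]: "h \<in> borel_measurable borel"
    by (rule borel_measurable_LIMSEQ_metric[OF _ lim]) measurable
  define s where "s i x = (if norm (q' i x) \<le> 2 * norm (h x) then q' i x else 0)" for i x
  have "simple_function lborel (s i)" for i
    unfolding s_def by (intro simple_function_If q') auto
  moreover have "(\<lambda>i. s i x) \<longlonglongrightarrow> h x" for x
  proof (cases "h x = 0")
    case True
    then have "s i x = 0" for i by (auto simp: s_def)
    with True show ?thesis by simp
  next
    case False
    have "(\<lambda>i. norm (q' i x)) \<longlonglongrightarrow> norm (h x)" by (intro tendsto_norm lim)
    then have "eventually (\<lambda>i. norm (q' i x) < 2 * norm (h x)) sequentially"
      by (rule order_tendstoD) (use False in auto)
    then have "eventually (\<lambda>i. q' i x = s i x) sequentially"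
      by eventually_elim (simp add: s_def)
    with lim show ?thesis by (rule Lim_transform_eventually)
  qed
  moreover have "norm (s i x) \<le> 2 * norm (h x)" for i x by (simp add: s_def)
  moreover have "h x = 0" if "x \<notin> {t0..t1}" for x using that by (auto simp: h_def D_def)
  moreover have "AE x in lebesgue_on {t0..t1}. f x = h x"
  proof -
    have "AE x in lborel. x \<notin> N" using N(1) by (rule AE_not_in)
    then have "AE x in lborel. x \<in> {t0..t1} \<longrightarrow> f x = h x"
      by eventually_elim (simp add: h_def D_def)
    then show ?thesis by (simp add: AE_restrict_space_iff AE_completion_iff)
  qed
  ultimately show ?thesis by (rule that)
qed

section \<open>Existence and measurability of the fractional integral\<close>

text \<open>
  The integrand of the fractional integral exactly as it appears there; on \<open>[t\<^sub>0,t]\<close> it agrees with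
  \<open>fractional_kernel\<close> times \<open>f\<close>.
\<close>
abbreviation weighted :: "real \<Rightarrow> real \<Rightarrow> (real \<Rightarrow> 'a::real_normed_vector) \<Rightarrow> real \<Rightarrow> 'a" where
  "weighted \<alpha> t f \<equiv> (\<lambda>s. ((t - s) powr (\<alpha> - 1)) *\<^sub>R f s)"

lemma nn_integral_norm_weighted:
  fixes f :: "real \<Rightarrow> 'a::real_normed_vector"
  shows "(\<integral>\<^sup>+s. norm (weighted \<alpha> t f s) \<partial>lebesgue_on {t0..t})
    = (\<integral>\<^sup>+s. ennreal (fractional_kernel \<alpha> t0 t s * norm (f s)) \<partial>lborel)"
  by (subst nn_integral_lebesgue_on) (auto intro!: nn_integral_cong simp: fractional_kernel_def indicator_def)

lemma has_strong_integral_weighted: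
  fixes h :: "real \<Rightarrow> 'a::banach"
  assumes s: "\<And>i. simple_function lborel (s i)" "\<And>x. (\<lambda>i::nat. s i x) \<longlonglongrightarrow> h x"
      "\<And>i x. norm (s i x) \<le> 2 * norm (h x)"
    and fin: "(\<integral>\<^sup>+x. ennreal (fractional_kernel \<alpha> t0 t x * norm (h x)) \<partial>lborel) < \<infinity>"
  shows "has_strong_integral (lebesgue_on {t0..t}) (weighted \<alpha> t h)
    (strong_integral (lebesgue_on {t0..t}) (weighted \<alpha> t h))"
proof -
  have "(\<lambda>x. (t - x) powr (\<alpha> - 1)) \<in> borel_measurable lborel" by measurable
  from borel_measurable_implies_sequence_metric[OF this, of 0]
  obtain k where k: "\<And>i. simple_function lborel (k i)"
    "\<And>x. (\<lambda>i::nat. k i x) \<longlonglongrightarrow> (t - x) powr (\<alpha> - 1)"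
    "\<And>i x. norm (k i x) \<le> 2 * (t - x) powr (\<alpha> - 1)"
    by auto
  have [measurable]: "h \<in> borel_measurable borel"
    by (rule borel_measurable_LIMSEQ_metric[OF _ s(2)])
       (use borel_measurable_simple_function[OF s(1)] in simp)
  have "(\<lambda>x. ennreal ((t - x) powr (\<alpha> - 1) * norm (h x))) \<in> borel_measurable lborel" by measurable
  then have "(\<lambda>x. ennreal (norm (weighted \<alpha> t h x))) \<in> borel_measurable lborel" by simp
  then have m: "(\<lambda>x. ennreal (norm (weighted \<alpha> t h x))) \<in> borel_measurable (lebesgue_on {t0..t})"
    by (intro measurable_restrict_space1 measurable_completion)
  show ?thesis
  proof (rule has_strong_integral_dominated[where s="\<lambda>i x. k i x *\<^sub>R s i x"
        and w="\<lambda>x. 4 * ennreal (norm (weighted \<alpha> t h x))"])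
    show "simple_function (lebesgue_on {t0..t}) (\<lambda>x. k i x *\<^sub>R s i x)" for i
      using simple_function_lebesgue_on[OF k(1)] simple_function_lebesgue_on[OF s(1)]
      by (rule simple_function_compose2)
    show "(\<lambda>i. k i x *\<^sub>R s i x) \<longlonglongrightarrow> weighted \<alpha> t h x" for x
      by (intro tendsto_scaleR k s)
    show "(\<lambda>x. 4 * ennreal (norm (weighted \<alpha> t h x))) \<in> borel_measurable (lebesgue_on {t0..t})"
      using m by measurable
    show "(\<integral>\<^sup>+ x. 4 * ennreal (norm (weighted \<alpha> t h x)) \<partial>lebesgue_on {t0..t}) < \<infinity>"
      using fin unfolding nn_integral_cmult[OF m] nn_integral_norm_weighted
      by (simp add: ennreal_mult_less_top)
    show "ennreal (norm (k i x *\<^sub>R s i x)) \<le> 4 * ennreal (norm (weighted \<alpha> t h x))" for i x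
    proof -
      have "norm (k i x) * norm (s i x) \<le> (2 * (t - x) powr (\<alpha> - 1)) * (2 * norm (h x))"
        by (intro mult_mono k s) auto
      then have "ennreal (norm (k i x *\<^sub>R s i x)) \<le> ennreal (4 * norm (weighted \<alpha> t h x))"
        by (intro ennreal_leI) simp
      also have "\<dots> = 4 * ennreal (norm (weighted \<alpha> t h x))" by (simp add: ennreal_mult)
      finally show ?thesis .
    qed
  qed
qed

text \<open>
  With the vectors pulled out, \<open>t\<close> enters only through scalar integrals of the kernel over the level
  sets of \<open>q\<close>, and these are Borel measurable in \<open>t\<close> by Tonelli's theorem.
\<close>
lemma strong_integral_weighted_simple:
  fixes q :: "real \<Rightarrow> 'a::banach"
  assumes q: "simple_function lborel q" and "0 < \<alpha>" "t0 \<le> t"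
  shows "has_strong_integral (lebesgue_on {t0..t}) (weighted \<alpha> t q)
    (\<Sum>v\<in>range q. enn2real (\<integral>\<^sup>+s. ennreal (fractional_kernel \<alpha> t0 t s * indicator (q -` {v}) s) \<partial>lborel) *\<^sub>R v)"
proof -
  have fin: "finite (range q)" using simple_functionD(1)[OF q] by simp
  have [measurable]: "q -` {v} \<in> sets borel" for v using simple_functionD(2)[OF q, of "{v}"] by simp
  have "has_strong_integral (lebesgue_on {t0..t})
      (\<lambda>s. \<Sum>v\<in>range q. ((t - s) powr (\<alpha> - 1) * indicator (q -` {v}) s) *\<^sub>R v)
      (\<Sum>v\<in>range q. enn2real (\<integral>\<^sup>+s. ennreal (fractional_kernel \<alpha> t0 t s * indicator (q -` {v}) s) \<partial>lborel) *\<^sub>R v)"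
  proof (intro has_strong_integral_sum has_strong_integral_bounded_linear[OF bounded_linear_scaleR_left]
      has_strong_integral_real has_bochner_integral_nn_integral)
    fix v
    have "(\<lambda>s. (t - s) powr (\<alpha> - 1) * indicat_real (q -` {v}) s) \<in> borel_measurable lborel" by measurable
    then show "(\<lambda>s. (t - s) powr (\<alpha> - 1) * indicat_real (q -` {v}) s) \<in> borel_measurable (lebesgue_on {t0..t})"
      by (intro measurable_restrict_space1 measurable_completion)
    have "(\<integral>\<^sup>+s. ennreal ((t - s) powr (\<alpha> - 1) * indicator (q -` {v}) s) \<partial>lebesgue_on {t0..t})
      = (\<integral>\<^sup>+s. ennreal (fractional_kernel \<alpha> t0 t s * indicator (q -` {v}) s) \<partial>lborel)"
      by (subst nn_integral_lebesgue_on) (auto intro!: nn_integral_cong simp: fractional_kernel_def indicator_def)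
    moreover have "\<dots> < top"
    proof -
      have "(\<integral>\<^sup>+s. ennreal (fractional_kernel \<alpha> t0 t s * indicator (q -` {v}) s) \<partial>lborel)
          \<le> (\<integral>\<^sup>+s. ennreal (fractional_kernel \<alpha> t0 t s) \<partial>lborel)"
        by (intro nn_integral_mono ennreal_leI) (auto simp: indicator_def)
      also have "\<dots> < top" using assms by (simp add: nn_integral_kernel_right)
      finally show ?thesis .
    qed
    ultimately show "(\<integral>\<^sup>+s. ennreal ((t - s) powr (\<alpha> - 1) * indicator (q -` {v}) s) \<partial>lebesgue_on {t0..t})
      = ennreal (enn2real (\<integral>\<^sup>+s. ennreal (fractional_kernel \<alpha> t0 t s * indicator (q -` {v}) s) \<partial>lborel))"
      by simp
  qed auto
  moreover have "(\<Sum>v\<in>range q. ((t - s) powr (\<alpha> - 1) * indicator (q -` {v}) s) *\<^sub>R v) = weighted \<alpha> t q s" for s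
  proof -
    have "(\<Sum>v\<in>range q. ((t - s) powr (\<alpha> - 1) * indicator (q -` {v}) s) *\<^sub>R v)
        = (\<Sum>v\<in>{q s}. ((t - s) powr (\<alpha> - 1) * indicator (q -` {v}) s) *\<^sub>R v)"
      using fin by (intro sum.mono_neutral_right) auto
    then show ?thesis by simp
  qed
  ultimately show ?thesis by simp
qed

lemma simple_function_uniform_approximation:
  fixes u :: "'m \<Rightarrow> real"
  assumes [measurable]: "u \<in> borel_measurable M" and "\<And>x. x \<in> space M \<Longrightarrow> 0 \<le> u x \<and> u x \<le> B" "0 < e"
  obtains v where "simple_function M v" "\<And>x. x \<in> space M \<Longrightarrow> \<bar>u x - v x\<bar> \<le> e"
proof
  define v where "v x = e * of_int \<lfloor>u x / e\<rfloor>" for x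
  show "simple_function M v"
  proof (rule simple_function_borel_measurable)
    show "v \<in> borel_measurable M" unfolding v_def by measurable
    have "v ` space M \<subseteq> (\<lambda>n. e * of_int n) ` {0..\<lfloor>B / e\<rfloor>}"
    proof
      fix y assume "y \<in> v ` space M"
      then obtain x where x: "x \<in> space M" "y = v x" by auto
      then have "\<lfloor>u x / e\<rfloor> \<in> {0..\<lfloor>B / e\<rfloor>}"
        using assms(2)[of x] \<open>0 < e\<close> by (auto intro!: floor_mono divide_right_mono)
      then show "y \<in> (\<lambda>n. e * of_int n) ` {0..\<lfloor>B / e\<rfloor>}" using x by (auto simp: v_def)
    qed
    then show "finite (v ` space M)" by (rule finite_subset) auto
  qed
  show "\<bar>u x - v x\<bar> \<le> e" for x
  proof -
    have "u x - v x = e * (u x / e - of_int \<lfloor>u x / e\<rfloor>)"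
      using \<open>0 < e\<close> by (simp add: v_def field_simps)
    moreover have "0 \<le> u x / e - of_int \<lfloor>u x / e\<rfloor>" "u x / e - of_int \<lfloor>u x / e\<rfloor> \<le> 1"
      by linarith+
    ultimately show ?thesis
      using \<open>0 < e\<close> by (simp add: abs_mult mult_left_le)
  qed
qed

text \<open>
  The coefficients in \<open>strong_integral_weighted_simple\<close> lie between 0 and the mass of the kernel,
  so they can be rounded to finitely many values.  A uniform error, rather than convergence for
  each fixed \<open>q\<close>, makes it possible to let the error and \<open>q\<close> vary together along one sequence.
\<close>
lemma strong_integral_weighted_simple_approximation:
  fixes q :: "real \<Rightarrow> 'a::banach"
  assumes q: "simple_function lborel q" and "0 < \<alpha>" "0 < e"
  obtains r where "simple_function (lebesgue_on {t0..t1}) r"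
    "\<And>t. t \<in> {t0..t1} \<Longrightarrow> norm (strong_integral (lebesgue_on {t0..t}) (weighted \<alpha> t q) - r t) \<le> e"
proof -
  define U where "U v t = enn2real (\<integral>\<^sup>+s. ennreal (fractional_kernel \<alpha> t0 t s * indicator (q -` {v}) s) \<partial>lborel)" for v t
  have fin: "finite (range q)" using simple_functionD(1)[OF q] by simp
  have [measurable]: "q -` {v} \<in> sets borel" for v using simple_functionD(2)[OF q, of "{v}"] by simp
  have "U v \<in> borel_measurable lborel" for v unfolding U_def by measurable
  then have meas: "U v \<in> borel_measurable (lebesgue_on {t0..t1})" for v
    by (intro measurable_restrict_space1 measurable_completion)
  have bound: "0 \<le> U v t \<and> U v t \<le> (t1 - t0) powr \<alpha> / \<alpha>" if "t \<in> {t0..t1}" for v t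
  proof -
    have "(\<integral>\<^sup>+s. ennreal (fractional_kernel \<alpha> t0 t s * indicator (q -` {v}) s) \<partial>lborel) \<le> (\<integral>\<^sup>+s. ennreal (fractional_kernel \<alpha> t0 t s) \<partial>lborel)"
      by (intro nn_integral_mono ennreal_leI) (auto simp: indicator_def)
    also have "\<dots> = ennreal ((t - t0) powr \<alpha> / \<alpha>)"
      using assms that by (intro nn_integral_kernel_right) auto
    also have "\<dots> \<le> ennreal ((t1 - t0) powr \<alpha> / \<alpha>)"
      using assms that by (intro ennreal_leI divide_right_mono powr_mono2) auto
    finally show ?thesis unfolding U_def using assms by (auto intro: enn2real_leI)
  qed
  \<comment> \<open>the summand 1 keeps \<open>S\<close> positive when \<open>q\<close> vanishes\<close>
  define S where "S = (\<Sum>v\<in>range q. norm v) + 1"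
  have S: "S > 0" unfolding S_def by (intro add_nonneg_pos sum_nonneg) auto
  have "\<exists>w. simple_function (lebesgue_on {t0..t1}) w \<and> (\<forall>t\<in>{t0..t1}. \<bar>U v t - w t\<bar> \<le> e / S)" for v
  proof -
    have range: "0 \<le> U v t \<and> U v t \<le> (t1 - t0) powr \<alpha> / \<alpha>" if "t \<in> space (lebesgue_on {t0..t1})" for t
      using bound[of t v] that by simp
    have "0 < e / S" using S \<open>0 < e\<close> by simp
    then obtain w where "simple_function (lebesgue_on {t0..t1}) w"
      "\<And>t. t \<in> space (lebesgue_on {t0..t1}) \<Longrightarrow> \<bar>U v t - w t\<bar> \<le> e / S"
      using simple_function_uniform_approximation[OF meas[of v] range] by blast
    then show ?thesis by auto
  qed
  then obtain w where w: "\<And>v. simple_function (lebesgue_on {t0..t1}) (w v)"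
    "\<And>v t. t \<in> {t0..t1} \<Longrightarrow> \<bar>U v t - w v t\<bar> \<le> e / S"
    by metis
  show ?thesis
  proof
    show "simple_function (lebesgue_on {t0..t1}) (\<lambda>t. \<Sum>v\<in>range q. w v t *\<^sub>R v)"
      by (intro simple_function_sum simple_function_compose1[OF w(1)])
    fix t assume t: "t \<in> {t0..t1}"
    have "strong_integral (lebesgue_on {t0..t}) (weighted \<alpha> t q) = (\<Sum>v\<in>range q. U v t *\<^sub>R v)"
      unfolding U_def using t assms by (intro strong_integral_eq strong_integral_weighted_simple) auto
    then have "norm (strong_integral (lebesgue_on {t0..t}) (weighted \<alpha> t q) - (\<Sum>v\<in>range q. w v t *\<^sub>R v))
        = norm (\<Sum>v\<in>range q. (U v t - w v t) *\<^sub>R v)"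
      by (simp add: sum_subtractf scaleR_diff_left)
    also have "\<dots> \<le> (\<Sum>v\<in>range q. e / S * norm v)"
    proof (rule sum_norm_le)
      fix v
      have "\<bar>U v t - w v t\<bar> * norm v \<le> e / S * norm v"
        by (intro mult_right_mono w t) simp
      then show "norm ((U v t - w v t) *\<^sub>R v) \<le> e / S * norm v" by simp
    qed
    also have "\<dots> = e / S * (\<Sum>v\<in>range q. norm v)" by (simp add: sum_distrib_left)
    also have "\<dots> \<le> e / S * S" unfolding S_def[symmetric] using S assms
      by (intro mult_left_mono) (auto simp: S_def)
    also have "\<dots> = e" using S by simp
    finally show "norm (strong_integral (lebesgue_on {t0..t}) (weighted \<alpha> t q) - (\<Sum>v\<in>range q. w v t *\<^sub>R v)) \<le> e" .
  qed
qed

lemma strong_integral_weighted_tendsto: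
  fixes h :: "real \<Rightarrow> 'a::banach"
  assumes s: "\<And>i. simple_function lborel (s i)" "\<And>x. (\<lambda>i::nat. s i x) \<longlonglongrightarrow> h x"
      "\<And>i x. norm (s i x) \<le> 2 * norm (h x)"
    and fin: "(\<integral>\<^sup>+x. ennreal (fractional_kernel \<alpha> t0 t x * norm (h x)) \<partial>lborel) < \<infinity>"
    and "0 < \<alpha>" "t0 \<le> t"
  shows "(\<lambda>i. strong_integral (lebesgue_on {t0..t}) (weighted \<alpha> t (s i)))
    \<longlonglongrightarrow> strong_integral (lebesgue_on {t0..t}) (weighted \<alpha> t h)"
proof -
  let ?M = "lebesgue_on {t0..t}"
  have [measurable]: "s i \<in> borel_measurable borel" for i
    using borel_measurable_simple_function[OF s(1)] by simp
  have [measurable]: "h \<in> borel_measurable borel"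
    by (rule borel_measurable_LIMSEQ_metric[OF _ s(2)]) measurable
  have [measurable]: "(\<lambda>x. norm (h x - s i x)) \<in> borel_measurable borel" for i
  proof -
    have "(\<lambda>x. s j x - s i x) \<in> borel_measurable lborel" for j
      using simple_function_compose2[OF s(1) s(1), where h="(-)"] by (rule borel_measurable_simple_function)
    then have "(\<lambda>x. h x - s i x) \<in> borel_measurable lborel"
      by (rule borel_measurable_LIMSEQ_metric[where f="\<lambda>j x. s j x - s i x"])
         (intro tendsto_diff s tendsto_const)
    then show ?thesis by simp
  qed
  define E where "E i = (\<integral>\<^sup>+x. ennreal (fractional_kernel \<alpha> t0 t x * norm (h x - s i x)) \<partial>lborel)" for i
  have "E \<longlonglongrightarrow> (\<integral>\<^sup>+x. 0 \<partial>(lborel :: real measure))"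
    unfolding E_def
  proof (rule nn_integral_dominated_convergence[where w="\<lambda>x. 3 * ennreal (fractional_kernel \<alpha> t0 t x * norm (h x))"])
    show "AE x in lborel. ennreal (fractional_kernel \<alpha> t0 t x * norm (h x - s i x)) \<le> 3 * ennreal (fractional_kernel \<alpha> t0 t x * norm (h x))" for i
    proof (rule AE_I2)
      fix x
      have "norm (h x - s i x) \<le> 3 * norm (h x)"
        using norm_triangle_ineq4[of "h x" "s i x"] s(3)[of i x] by simp
      then have "ennreal (fractional_kernel \<alpha> t0 t x * norm (h x - s i x)) \<le> ennreal (fractional_kernel \<alpha> t0 t x * (3 * norm (h x)))"
        by (intro ennreal_leI mult_left_mono) auto
      also have "\<dots> = ennreal (3 * (fractional_kernel \<alpha> t0 t x * norm (h x)))" by (simp add: ac_simps)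
      also have "\<dots> = 3 * ennreal (fractional_kernel \<alpha> t0 t x * norm (h x))" by (subst ennreal_mult) auto
      finally show "ennreal (fractional_kernel \<alpha> t0 t x * norm (h x - s i x)) \<le> 3 * ennreal (fractional_kernel \<alpha> t0 t x * norm (h x))" .
    qed
    show "AE x in lborel. (\<lambda>i. ennreal (fractional_kernel \<alpha> t0 t x * norm (h x - s i x))) \<longlonglongrightarrow> 0"
    proof (rule AE_I2)
      fix x
      have "(\<lambda>i. fractional_kernel \<alpha> t0 t x * norm (h x - s i x)) \<longlonglongrightarrow> fractional_kernel \<alpha> t0 t x * norm (h x - h x)"
        by (intro tendsto_mult tendsto_const tendsto_norm tendsto_diff s)
      from tendsto_ennrealI[OF this] show "(\<lambda>i. ennreal (fractional_kernel \<alpha> t0 t x * norm (h x - s i x))) \<longlonglongrightarrow> 0" by simp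
    qed
    show "(\<integral>\<^sup>+x. 3 * ennreal (fractional_kernel \<alpha> t0 t x * norm (h x)) \<partial>lborel) < \<infinity>"
      using fin by (subst nn_integral_cmult) (auto simp: ennreal_mult_less_top)
  qed measurable
  then have E: "E \<longlonglongrightarrow> 0" by simp
  have le: "ennreal (norm (strong_integral ?M (weighted \<alpha> t h) - strong_integral ?M (weighted \<alpha> t (s i)))) \<le> E i" for i
  proof -
    have hs: "has_strong_integral ?M (weighted \<alpha> t (s i)) (strong_integral ?M (weighted \<alpha> t (s i)))"
      using strong_integral_weighted_simple[OF s(1) \<open>0 < \<alpha>\<close> \<open>t0 \<le> t\<close>, of i]
      by (simp only: strong_integral_eq)
    have "ennreal (norm (strong_integral ?M (weighted \<alpha> t h) - strong_integral ?M (weighted \<alpha> t (s i))))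
      \<le> (\<integral>\<^sup>+x. norm (weighted \<alpha> t h x - weighted \<alpha> t (s i) x) \<partial>?M)"
      by (intro norm_has_strong_integral_le has_strong_integral_diff hs has_strong_integral_weighted[OF s fin])
    also have "\<dots> = (\<integral>\<^sup>+x. norm (weighted \<alpha> t (\<lambda>x. h x - s i x) x) \<partial>?M)"
      by (simp add: scaleR_diff_right)
    also have "\<dots> = E i" unfolding E_def by (rule nn_integral_norm_weighted)
    finally show ?thesis .
  qed
  have "(\<lambda>i. ennreal (norm (strong_integral ?M (weighted \<alpha> t h) - strong_integral ?M (weighted \<alpha> t (s i))))) \<longlonglongrightarrow> ennreal 0"
    using ennreal_tendsto_0_le[OF le E] by simp
  then have "(\<lambda>i. norm (strong_integral ?M (weighted \<alpha> t h) - strong_integral ?M (weighted \<alpha> t (s i)))) \<longlonglongrightarrow> 0"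
    by (subst (asm) tendsto_ennreal_iff) auto
  then have "(\<lambda>i. strong_integral ?M (weighted \<alpha> t h) - strong_integral ?M (weighted \<alpha> t (s i))) \<longlonglongrightarrow> 0"
    by (rule tendsto_norm_zero_cancel)
  from tendsto_diff[OF tendsto_const this, of "strong_integral ?M (weighted \<alpha> t h)"]
  show ?thesis by simp
qed

section \<open>The norm estimate\<close>

text \<open>
  Every constant \<open>C\<close> that bounds the columns of the weighted kernel bounds the \<open>p\<close>-th power of
  \<open>\<Gamma>(\<alpha>) J\<^bsup>\<alpha>\<^esup>\<close> on \<open>L\<^bsup>p\<^esup>\<close>.  The weighted Tonelli estimate is used twice: it yields the norm bound, and
  its finiteness shows that the Bochner integral exists for almost every \<open>t\<close>, from which
  strong measurability follows.
\<close>
lemma fractional_integral_bound: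
  fixes f :: "real \<Rightarrow> 'a::banach" and t0 t1 \<alpha> p C :: real
  assumes t: "t0 < t1" and \<alpha>: "0 < \<alpha>" and p: "1 < p"
    and C: "\<And>s. s \<in> {t0..t1} \<Longrightarrow>
      (\<integral>\<^sup>+t. ennreal (((t - t0) powr \<alpha> / \<alpha>) powr (p - 1) * fractional_kernel \<alpha> t0 t s) * indicator {t0..t1} t \<partial>lborel) \<le> ennreal C"
    and f: "f \<in> Lp_space p t0 t1"
  shows "fractional_integral \<alpha> t0 f \<in> Lp_space p t0 t1 \<and>
    (\<integral>\<^sup>+t. ennreal (norm (fractional_integral \<alpha> t0 f t) powr p) \<partial>lebesgue_on {t0..t1})
      \<le> ennreal (C / Gamma \<alpha> powr p) * (\<integral>\<^sup>+t. ennreal (norm (f t) powr p) \<partial>lebesgue_on {t0..t1})"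
proof -
  let ?L = "lebesgue_on {t0..t1}"
  have fm: "strongly_measurable ?L f" and ffin: "(\<integral>\<^sup>+t. ennreal (norm (f t) powr p) \<partial>?L) < \<infinity>"
    using f unfolding Lp_space_def by auto
  obtain h s where s: "\<And>i. simple_function lborel (s i)" "\<And>x. (\<lambda>i::nat. s i x) \<longlonglongrightarrow> h x"
      "\<And>i x. norm (s i x) \<le> 2 * norm (h x)"
    and supp: "\<And>x. x \<notin> {t0..t1} \<Longrightarrow> h x = 0"
    and fh: "AE x in ?L. f x = h x"
    by (rule strongly_measurable_representative[OF fm]) (rule that; assumption)
  have [measurable]: "h \<in> borel_measurable borel"
    by (rule borel_measurable_LIMSEQ_metric[OF _ s(2)])
       (use borel_measurable_simple_function[OF s(1)] in simp)
  define J where "J t = strong_integral (lebesgue_on {t0..t}) (weighted \<alpha> t h)" for t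
  have frac: "fractional_integral \<alpha> t0 f t = (1 / Gamma \<alpha>) *\<^sub>R J t" if "t \<in> {t0..t1}" for t
  proof -
    have "AE x in lborel. x \<in> {t0..t1} \<longrightarrow> f x = h x"
      using fh by (simp add: AE_restrict_space_iff AE_completion_iff)
    then have "AE x in lborel. x \<in> {t0..t} \<longrightarrow> weighted \<alpha> t f x = weighted \<alpha> t h x"
      by eventually_elim (use that in auto)
    then have "AE x in lebesgue_on {t0..t}. weighted \<alpha> t f x = weighted \<alpha> t h x"
      by (simp add: AE_restrict_space_iff AE_completion_iff)
    then show ?thesis
      unfolding fractional_integral_def J_def by (simp add: strong_integral_cong_AE)
  qed
  define K where "K t = (t - t0) powr \<alpha> / \<alpha>" for t
  define A where "A t = (\<integral>\<^sup>+s. ennreal (fractional_kernel \<alpha> t0 t s * norm (h s) powr p) \<partial>lborel)" for t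
  have [measurable]: "K \<in> borel_measurable borel" "A \<in> borel_measurable borel"
    unfolding K_def A_def by measurable
  have K_pos: "K t > 0" if "t > t0" for t using that \<alpha> by (simp add: K_def)
  have K: "(\<integral>\<^sup>+s. ennreal (fractional_kernel \<alpha> t0 t s) \<partial>lborel) = ennreal (K t)" if "t \<ge> t0" for t
    unfolding K_def using \<alpha> that by (rule nn_integral_kernel_right)
  have hint: "(\<integral>\<^sup>+t. ennreal (norm (f t) powr p) \<partial>?L) = (\<integral>\<^sup>+t. ennreal (norm (h t) powr p) \<partial>lborel)"
  proof -
    have "(\<integral>\<^sup>+t. ennreal (norm (f t) powr p) \<partial>?L) = (\<integral>\<^sup>+t. ennreal (norm (h t) powr p) \<partial>?L)"
      using fh by (intro nn_integral_cong_AE) auto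
    also have "\<dots> = (\<integral>\<^sup>+t. ennreal (norm (h t) powr p) \<partial>lborel)"
      using supp by (subst nn_integral_lebesgue_on) (auto intro!: nn_integral_cong simp: indicator_def)
    finally show ?thesis .
  qed
  have main: "(\<integral>\<^sup>+t. (ennreal (K t powr (p - 1)) * A t) * indicator {t0..t1} t \<partial>lborel)
      \<le> ennreal C * (\<integral>\<^sup>+t. ennreal (norm (h t) powr p) \<partial>lborel)"
    unfolding A_def by (rule weighted_fubini) (use supp C in \<open>auto simp: K_def\<close>)
  \<comment> \<open>at \<open>t0\<close> the weight vanishes, and says nothing about \<open>A t0\<close>\<close>
  have neq: "AE t in lborel. t \<noteq> t0" by (rule AE_lborel_singleton)
  have "AE t in lborel. (ennreal (K t powr (p - 1)) * A t) * indicator {t0..t1} t \<noteq> \<infinity>"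
  proof (rule nn_integral_PInf_AE)
    show "(\<integral>\<^sup>+t. (ennreal (K t powr (p - 1)) * A t) * indicator {t0..t1} t \<partial>lborel) \<noteq> \<infinity>"
      using main ffin unfolding hint by (auto simp: ennreal_mult_eq_top_iff top_unique)
  qed measurable
  then have Afin: "AE t in lborel. t \<in> {t0..t1} \<longrightarrow> A t < \<infinity>"
    using neq
  proof eventually_elim
    case (elim t)
    then show ?case
      using K_pos[of t] by (auto simp: ennreal_mult_eq_top_iff less_top)
  qed
  \<comment> \<open>the scaled Young inequality with \<open>r = 1\<close>\<close>
  have Ifin: "(\<integral>\<^sup>+x. ennreal (fractional_kernel \<alpha> t0 t x * norm (h x)) \<partial>lborel) < \<infinity>" if "t \<in> {t0..t1}" "A t < \<infinity>" for t
  proof -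
    have "(\<integral>\<^sup>+x. ennreal (fractional_kernel \<alpha> t0 t x * norm (h x)) \<partial>lborel)
      \<le> ennreal (1 powr (1 - p) / p) * A t + ennreal (1 * (1 - 1 / p)) * ennreal (K t)"
      unfolding A_def using that
      by (subst K[symmetric], simp) (intro nn_integral_young p, auto)
    also have "\<dots> < \<infinity>" using that(2) by (simp add: ennreal_mult_less_top)
    finally show ?thesis .
  qed
  have Jlim: "AE t in lborel. t \<in> {t0..t1} \<longrightarrow>
      (\<lambda>i. strong_integral (lebesgue_on {t0..t}) (weighted \<alpha> t (s i))) \<longlonglongrightarrow> J t"
    using Afin
  proof eventually_elim
    case (elim t)
    then show ?case
      unfolding J_def using strong_integral_weighted_tendsto[OF s Ifin \<alpha>] by auto
  qed
  have "strongly_measurable ?L J"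
  proof -
    have "\<exists>r. simple_function ?L r \<and> (\<forall>t\<in>{t0..t1}.
        norm (strong_integral (lebesgue_on {t0..t}) (weighted \<alpha> t (s i)) - r t) \<le> 1 / Suc i)" for i
      by (rule strong_integral_weighted_simple_approximation[OF s(1)[of i] \<alpha>, of "1 / Suc i" t0 t1]) auto
    then obtain r where r: "\<And>i. simple_function ?L (r i)"
      "\<And>i t. t \<in> {t0..t1} \<Longrightarrow>
        norm (strong_integral (lebesgue_on {t0..t}) (weighted \<alpha> t (s i)) - r i t) \<le> 1 / Suc i"
      by metis
    have "AE t in lborel. t \<in> {t0..t1} \<longrightarrow> (\<lambda>i. r i t) \<longlonglongrightarrow> J t"
      using Jlim
    proof eventually_elim
      case (elim t)
      show ?case
      proof
        assume t: "t \<in> {t0..t1}"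
        have "(\<lambda>i. strong_integral (lebesgue_on {t0..t}) (weighted \<alpha> t (s i)) - r i t) \<longlonglongrightarrow> 0"
          by (rule Lim_null_comparison[OF _ LIMSEQ_inverse_real_of_nat])
             (use r(2)[OF t] in \<open>auto simp: inverse_eq_divide\<close>)
        from tendsto_diff[OF elim[rule_format, OF t] this]
        show "(\<lambda>i. r i t) \<longlonglongrightarrow> J t" by simp
      qed
    qed
    then have "AE t in ?L. (\<lambda>i. r i t) \<longlonglongrightarrow> J t"
      by (simp add: AE_restrict_space_iff AE_completion_iff)
    with r(1) show ?thesis unfolding strongly_measurable_def by blast
  qed
  then have "strongly_measurable ?L (\<lambda>t. (1 / Gamma \<alpha>) *\<^sub>R J t)"
    by (rule strongly_measurable_bounded_linear[OF bounded_linear_scaleR_right])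
  then have sm: "strongly_measurable ?L (fractional_integral \<alpha> t0 f)"
    by (rule strongly_measurable_cong_AE[rotated]) (auto simp: frac intro!: AE_I2)
  have G: "Gamma \<alpha> > 0" using \<alpha> by (rule Gamma_real_pos)
  have pointwise: "ennreal (norm (J t) powr p) \<le> ennreal (K t powr (p - 1)) * A t" if "t0 < t" for t
    unfolding A_def
  proof (rule powr_nn_integral_le[OF p])
    show "(\<integral>\<^sup>+s. ennreal (fractional_kernel \<alpha> t0 t s) \<partial>lborel) = ennreal (K t)" using K that by simp
    show "ennreal (norm (J t)) \<le> (\<integral>\<^sup>+s. ennreal (fractional_kernel \<alpha> t0 t s * norm (h s)) \<partial>lborel)"
      unfolding J_def nn_integral_norm_weighted[symmetric] by (rule norm_strong_integral_le)
  qed (use K_pos that in auto)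
  have interval: "{t0..t1} \<in> sets lebesgue" by simp
  have "(\<integral>\<^sup>+t. ennreal (norm (fractional_integral \<alpha> t0 f t) powr p) \<partial>?L)
      \<le> (\<integral>\<^sup>+t. ennreal (1 / Gamma \<alpha> powr p) * ((ennreal (K t powr (p - 1)) * A t) * indicator {t0..t1} t) \<partial>lborel)"
    unfolding nn_integral_lebesgue_on[OF interval]
    using neq
  proof (intro nn_integral_mono_AE, eventually_elim)
    case (elim t)
    show ?case
    proof (cases "t \<in> {t0..t1}")
      case True
      then have "ennreal (norm (fractional_integral \<alpha> t0 f t) powr p) = ennreal (1 / Gamma \<alpha> powr p) * ennreal (norm (J t) powr p)"
        using G by (simp add: frac powr_mult powr_divide flip: ennreal_mult)
      also have "\<dots> \<le> ennreal (1 / Gamma \<alpha> powr p) * (ennreal (K t powr (p - 1)) * A t)"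
        using True elim by (intro mult_left_mono pointwise) auto
      finally show ?thesis using True by simp
    qed simp
  qed
  also have "\<dots> = ennreal (1 / Gamma \<alpha> powr p) * (\<integral>\<^sup>+t. (ennreal (K t powr (p - 1)) * A t) * indicator {t0..t1} t \<partial>lborel)"
    by (rule nn_integral_cmult) measurable
  also have "\<dots> \<le> ennreal (1 / Gamma \<alpha> powr p) * (ennreal C * (\<integral>\<^sup>+t. ennreal (norm (h t) powr p) \<partial>lborel))"
    by (intro mult_left_mono main) simp
  also have "\<dots> = ennreal (C / Gamma \<alpha> powr p) * (\<integral>\<^sup>+t. ennreal (norm (f t) powr p) \<partial>?L)"
    unfolding hint by (simp add: ennreal_mult' mult.assoc[symmetric] flip: ennreal_mult')
  finally have le: "(\<integral>\<^sup>+t. ennreal (norm (fractional_integral \<alpha> t0 f t) powr p) \<partial>?L)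
      \<le> ennreal (C / Gamma \<alpha> powr p) * (\<integral>\<^sup>+t. ennreal (norm (f t) powr p) \<partial>?L)" .
  also have "\<dots> < \<infinity>" using ffin by (simp add: ennreal_mult_less_top)
  finally show ?thesis using sm le unfolding Lp_space_def by simp
qed

theorem theorem37:
  fixes t0 t1 \<alpha> p :: real
  assumes "t0 < t1" and "0 < \<alpha>" and "1 < p"
    and "reflexive_space TYPE('a::banach)"
  shows "Lp_operator_norm p t0 t1 (fractional_integral \<alpha> t0 :: (real \<Rightarrow> 'a) \<Rightarrow> real \<Rightarrow> 'a)
           < ennreal ((t1 - t0) powr \<alpha> / Gamma (\<alpha> + 1))"
proof -
  define K where "K = (t1 - t0) powr \<alpha> / \<alpha>"
  have K: "K > 0" using assms by (simp add: K_def)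
  have G: "Gamma \<alpha> > 0" using assms(2) by (rule Gamma_real_pos)
  obtain C where C: "0 \<le> C" "C < K powr p"
    "\<And>s. s \<in> {t0..t1} \<Longrightarrow>
      (\<integral>\<^sup>+t. ennreal (((t - t0) powr \<alpha> / \<alpha>) powr (p - 1) * fractional_kernel \<alpha> t0 t s) * indicator {t0..t1} t \<partial>lborel) \<le> ennreal C"
    using weighted_kernel_bound[OF assms(1-3)] unfolding K_def by blast
  define c where "c = C powr (1 / p) / Gamma \<alpha>"
  have "Lp_operator_norm p t0 t1 (fractional_integral \<alpha> t0 :: (real \<Rightarrow> 'a) \<Rightarrow> real \<Rightarrow> 'a) \<le> ennreal c"
    unfolding Lp_operator_norm_def
  proof (rule SUP_least)
    fix f :: "real \<Rightarrow> 'a" assume "f \<in> {f \<in> Lp_space p t0 t1. Lp_norm p t0 t1 f \<le> 1}"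
    then have f: "f \<in> Lp_space p t0 t1" "Lp_norm p t0 t1 f \<le> 1" by auto
    define F where "F = (\<integral>\<^sup>+t. ennreal (norm (f t) powr p) \<partial>lebesgue_on {t0..t1})"
    have "enn2real F \<le> 1"
    proof (rule ccontr)
      assume "\<not> enn2real F \<le> 1"
      then have "1 powr (1 / p) < enn2real F powr (1 / p)"
        using assms(3) by (intro powr_less_mono2) auto
      with f(2) show False by (simp add: Lp_norm_def F_def)
    qed
    moreover have "F < \<infinity>" using f(1) by (simp add: Lp_space_def F_def)
    ultimately have F: "F \<le> 1"
      by (cases F) auto
    have b: "fractional_integral \<alpha> t0 f \<in> Lp_space p t0 t1"
      "(\<integral>\<^sup>+t. ennreal (norm (fractional_integral \<alpha> t0 f t) powr p) \<partial>lebesgue_on {t0..t1})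
        \<le> ennreal (C / Gamma \<alpha> powr p) * F"
      using fractional_integral_bound[OF assms(1-3) C(3) f(1)] unfolding F_def by auto
    have "ennreal (C / Gamma \<alpha> powr p) * F \<le> ennreal (C / Gamma \<alpha> powr p) * 1"
      by (intro mult_left_mono F) simp
    with b(2) have "enn2real (\<integral>\<^sup>+t. ennreal (norm (fractional_integral \<alpha> t0 f t) powr p) \<partial>lebesgue_on {t0..t1})
        \<le> C / Gamma \<alpha> powr p"
      using C(1) by (intro enn2real_leI) auto
    then have "Lp_norm p t0 t1 (fractional_integral \<alpha> t0 f) \<le> (C / Gamma \<alpha> powr p) powr (1 / p)"
      unfolding Lp_norm_def using assms(3) by (intro powr_mono2) auto
    also have "\<dots> = c"
      unfolding c_def using G C(1) assms(3) by (simp add: powr_divide powr_powr)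
    finally show "(if fractional_integral \<alpha> t0 f \<in> Lp_space p t0 t1
        then ennreal (Lp_norm p t0 t1 (fractional_integral \<alpha> t0 f)) else \<infinity>) \<le> ennreal c"
      using b(1) by (simp add: ennreal_leI)
  qed
  also have "ennreal c < ennreal ((t1 - t0) powr \<alpha> / Gamma (\<alpha> + 1))"
  proof (rule ennreal_lessI)
    have "C powr (1 / p) < (K powr p) powr (1 / p)"
      using C assms(3) by (intro powr_less_mono2) auto
    also have "\<dots> = K" using K assms(3) by (simp add: powr_powr)
    finally have "c < K / Gamma \<alpha>" unfolding c_def using G by (rule divide_strict_right_mono)
    also have "\<dots> = (t1 - t0) powr \<alpha> / Gamma (\<alpha> + 1)"
    proof -
      have "\<alpha> \<notin> \<int>\<^sub>\<le>\<^sub>0" using assms(2) by (auto elim!: nonpos_Ints_cases)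
      then show ?thesis using Gamma_plus1[of \<alpha>] by (simp add: K_def)
    qed
    finally show "c < (t1 - t0) powr \<alpha> / Gamma (\<alpha> + 1)" .
    show "0 < (t1 - t0) powr \<alpha> / Gamma (\<alpha> + 1)"
      using assms Gamma_real_pos[of "\<alpha> + 1"] by simp
  qed
  finally show ?thesis .
qed

end
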